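(* Let $\mathcal{B}$ be a Hopf algebra with antipode $S$ and let $L:\mathcal{B}\otimes\mathcal{B}\to\mathbb{C}$ be the generator of an additive deformation $(\mu_t)_{t\in\mathbb{R}}$, $\mu_t=\mu\star e_\star^{tL}$. Let $\sigma:=L\circ(\mathrm{id}\otimes S)\circ\Delta$. Then the additive deformation is a Hopf deformation, and the deformed antipodes are given by $$S_t=S\star e_\star^{-t\sigma}\qquad(t\in\mathbb{R}),$$ i.e. these maps satisfy $\mu_t\circ(S_t\otimes\mathrm{id})\circ\Delta=\mu_t\circ(\mathrm{id}\otimes S_t)\circ\Delta=\mathbf 1\delta$ for all $t\in\mathbb{R}$.
   Context: All vector spaces are over $\mathbb{C}$. $(\mathcal{B},\mu,\mathbf 1,\Delta,\delta)$: multiplication, unit, comultiplication, counit; $\tau$ is the flip; $\mathbf 1\delta$ is the map $a\mapsto\delta(a)\mathbf 1$. $\mathcal{B}\otimes\mathcal{B}$ is a coalgebra with comultiplication $(\mathrm{id}\otimes\tau\otimes\mathrm{id})\circ(\Delta\otimes\Delta)$ and counit $\delta\otimes\delta$. Convolution: for linear maps $R,T$ from a coalgebra $(\mathcal C,\Delta_{\mathcal C})$ to an algebra with product $m$, $R\star T=m\circ(R\otimes T)\circ\Delta_{\mathcal C}$; scalar-valued maps may be convolved with $\mathcal B$-valued ones. E.g. $(S\star\varphi)(a)=S(a_{(1)})\varphi(a_{(2)})$, $(\mu\star L)(a\otimes b)=a_{(1)}b_{(1)}L(a_{(2)}\otimes b_{(2)})$. For a linear functional $f$ on a coalgebra, $e_\star^f=\sum_{n\ge0}f^{\star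 n}/n!$ (pointwise convergent), $f^{\star0}$ being the counit. An additive deformation of a bialgebra $\mathcal{B}$ is a family $(\mu_t)_{t\ge0}$ of linear maps $\mathcal{B}\otimes\mathcal{B}\to\mathcal{B}$ with $(\mathcal{B},\mu_t,\mathbf 1)$ a unital algebra for each $t$, $\mu_0=\mu$, $\Delta\circ\mu_{t+s}=(\mu_t\otimes\mu_s)\circ(\mathrm{id}\otimes\tau\otimes\mathrm{id})\circ(\Delta\otimes\Delta)$, and $\delta\circ\mu_t\to\delta\otimes\delta$ pointwise as $t\to0$. Its generator is $L=\frac{\mathrm d}{\mathrm dt}(\delta\circ\mu_t)|_{t=0}$. By a theorem of Wirth (known), $\mu_t=\mu\star e_\star^{tL}$, and the generators of additive deformations are exactly the linear maps $L:\mathcal{B}\otimes\mathcal{B}\to\mathbb{C}$ with: $\mu\star L=L\star\mu$ (commuting); $L(\mathbf 1\otimes\mathbf 1)=0$ (normalized); $\delta(a)L(b\otimes c)-L(ab\otimes c)+L(a\otimes bc)-L(a\otimes b)\delta(c)=0$ for all $a,b,c$ (2-cocycle). An additive deformation is always viewed as a family indexed by all $t\in\mathbb{R}$ via $\mu_t=\mu\star e_\star^{tL}$. An additive deformation is a Hopf deformation if for all $t\in\mathbb{R}$ there is a linear map $S_t:\mathcal{B}\to\mathcal{B}$ with $\mu_t\circ(S_t\otimes\mathrm{id})\circ\Delta=\mu_t\circ(\mathrm{id}\otimes S_t)\circ\Delta=\mathbf 1\delta$; the $S_t$ are called deformed antipodes. *)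

theory Defs
  imports Complex_Main "HOL-Library.Poly_Mapping"
begin

section \<open>Complex vector spaces\<close>

class complex_vector = ab_group_add +
  fixes scaleC :: "complex \<Rightarrow> 'a \<Rightarrow> 'a"  (infixr \<open>*\<^sub>C\<close> 75)
  assumes scaleC_add_right: "c *\<^sub>C (x + y) = c *\<^sub>C x + c *\<^sub>C y"
    and scaleC_add_left: "(c + d) *\<^sub>C x = c *\<^sub>C x + d *\<^sub>C x"
    and scaleC_scaleC: "c *\<^sub>C d *\<^sub>C x = (c * d) *\<^sub>C x"
    and scaleC_one: "1 *\<^sub>C x = x"

global_interpretation complex_vector: vector_space "scaleC :: complex \<Rightarrow> 'a \<Rightarrow> 'a::complex_vector"
  by unfold_locales (simp_all add: scaleC_add_right scaleC_add_left scaleC_scaleC scaleC_one)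

abbreviation clinear :: "('a::complex_vector \<Rightarrow> 'b::complex_vector) \<Rightarrow> bool"
  where "clinear \<equiv> Vector_Spaces.linear scaleC scaleC"

lemma clinear_iff:
  "clinear f \<longleftrightarrow> (\<forall>x y. f (x + y) = f x + f y) \<and> (\<forall>c x. f (c *\<^sub>C x) = c *\<^sub>C f x)"
  by (simp add: Vector_Spaces.linear_iff complex_vector.vector_space_axioms)

lemma clinear_compose: "clinear f \<Longrightarrow> clinear g \<Longrightarrow> clinear (g \<circ> f)"
  by (simp add: clinear_iff)

lemma clinear_id: "clinear id"
  by (simp add: clinear_iff)

definition cbilinear :: "('a::complex_vector \<Rightarrow> 'b::complex_vector \<Rightarrow> 'c::complex_vector) \<Rightarrow> bool"
  where "cbilinear \<beta> \<longleftrightarrow> (\<forall>b. clinear (\<lambda>a. \<beta> a b)) \<and> (\<forall>a. clinear (\<beta> a))"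

instantiation complex :: complex_vector
begin
definition scaleC_complex :: "complex \<Rightarrow> complex \<Rightarrow> complex"
  where [simp]: "scaleC_complex c x = c * x"
instance by standard (simp_all add: algebra_simps)
end

instantiation poly_mapping :: (type, complex_vector) complex_vector
begin
definition scaleC_poly_mapping :: "complex \<Rightarrow> ('a \<Rightarrow>\<^sub>0 'b) \<Rightarrow> ('a \<Rightarrow>\<^sub>0 'b)"
  where "scaleC_poly_mapping c = Poly_Mapping.map (scaleC c)"
lemma lookup_scaleC [simp]:
  "Poly_Mapping.lookup (c *\<^sub>C p) k = c *\<^sub>C Poly_Mapping.lookup p k"
  by (simp add: scaleC_poly_mapping_def Poly_Mapping.map.rep_eq when_def)
instance
  by standard (auto intro!: poly_mapping_eqI
      simp: lookup_add scaleC_add_right scaleC_add_left scaleC_scaleC scaleC_one)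
end


section \<open>The tensor product\<close>

text \<open>The free vector space on \<open>'a \<times> 'b\<close> modulo the bilinearity relations.\<close>

definition tensor_relators :: "('a::complex_vector \<times> 'b::complex_vector \<Rightarrow>\<^sub>0 complex) set" where
  "tensor_relators =
     {Poly_Mapping.single (a + a', b) 1 - Poly_Mapping.single (a, b) 1
        - Poly_Mapping.single (a', b) 1 | a a' b. True}
   \<union> {Poly_Mapping.single (a, b + b') 1 - Poly_Mapping.single (a, b) 1
        - Poly_Mapping.single (a, b') 1 | a b b'. True}
   \<union> {Poly_Mapping.single (c *\<^sub>C a, b) 1 - c *\<^sub>C Poly_Mapping.single (a, b) 1 | c a b. True}
   \<union> {Poly_Mapping.single (a, c *\<^sub>C b) 1 - c *\<^sub>C Poly_Mapping.single (a, b) 1 | c a b. True}"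

definition tensor_rel ::
    "('a::complex_vector \<times> 'b::complex_vector \<Rightarrow>\<^sub>0 complex) \<Rightarrow> ('a \<times> 'b \<Rightarrow>\<^sub>0 complex) \<Rightarrow> bool"
  where "tensor_rel p q \<longleftrightarrow> p - q \<in> complex_vector.span tensor_relators"

lemma tensor_rel_equivp:
  "equivp (tensor_rel :: ('a::complex_vector \<times> 'b::complex_vector \<Rightarrow>\<^sub>0 complex) \<Rightarrow> _)"
  (is "equivp ?R")
proof (rule equivpI)
  show "reflp ?R"
    by (simp add: reflp_def tensor_rel_def complex_vector.span_zero)
  show "symp ?R"
    by (rule sympI) (metis tensor_rel_def complex_vector.span_neg minus_diff_eq)
  show "transp ?R"
  proof (rule transpI)
    fix p q r :: "'a \<times> 'b \<Rightarrow>\<^sub>0 complex"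
    assume "tensor_rel p q" "tensor_rel q r"
    then have "(p - q) + (q - r) \<in> complex_vector.span tensor_relators"
      unfolding tensor_rel_def by (rule complex_vector.span_add)
    then show "tensor_rel p r" by (simp add: tensor_rel_def)
  qed
qed

quotient_type (overloaded) ('a, 'b) tensor (infixl \<open>\<otimes>\<close> 70) =
    "'a::complex_vector \<times> 'b::complex_vector \<Rightarrow>\<^sub>0 complex" / tensor_rel
  by (rule tensor_rel_equivp)

instantiation tensor :: (complex_vector, complex_vector) complex_vector
begin

lift_definition zero_tensor :: "'a \<otimes> 'b" is 0 .

lift_definition plus_tensor :: "'a \<otimes> 'b \<Rightarrow> 'a \<otimes> 'b \<Rightarrow> 'a \<otimes> 'b" is "(+)"
  unfolding tensor_rel_def by (metis add_diff_add complex_vector.span_add)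

lift_definition minus_tensor :: "'a \<otimes> 'b \<Rightarrow> 'a \<otimes> 'b \<Rightarrow> 'a \<otimes> 'b" is "(-)"
proof -
  fix p p' q q' :: "'a \<times> 'b \<Rightarrow>\<^sub>0 complex"
  assume "tensor_rel p p'" "tensor_rel q q'"
  then have "(p - p') - (q - q') \<in> complex_vector.span tensor_relators"
    unfolding tensor_rel_def by (rule complex_vector.span_diff)
  then show "tensor_rel (p - q) (p' - q')"
    by (simp add: tensor_rel_def algebra_simps)
qed

lift_definition uminus_tensor :: "'a \<otimes> 'b \<Rightarrow> 'a \<otimes> 'b" is uminus
  unfolding tensor_rel_def
  by (metis complex_vector.span_neg minus_diff_minus)

lift_definition scaleC_tensor :: "complex \<Rightarrow> 'a \<otimes> 'b \<Rightarrow> 'a \<otimes> 'b" is scaleC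
  unfolding tensor_rel_def
  by (metis complex_vector.span_scale complex_vector.scale_right_diff_distrib)

instance
proof
  show "x + y + z = x + (y + z)" for x y z :: "'a \<otimes> 'b"
    by transfer (simp add: equivp_reflp[OF tensor_rel_equivp] add.assoc)
  show "x + y = y + x" for x y :: "'a \<otimes> 'b"
    by transfer (simp add: equivp_reflp[OF tensor_rel_equivp] add.commute)
  show "0 + x = x" for x :: "'a \<otimes> 'b"
    by transfer (simp add: equivp_reflp[OF tensor_rel_equivp])
  show "- x + x = 0" for x :: "'a \<otimes> 'b"
    by transfer (simp add: equivp_reflp[OF tensor_rel_equivp])
  show "x - y = x + - y" for x y :: "'a \<otimes> 'b"
    by transfer (simp add: equivp_reflp[OF tensor_rel_equivp])
  show "c *\<^sub>C (x + y) = c *\<^sub>C x + c *\<^sub>C y" for c and x y :: "'a \<otimes> 'b"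
    by transfer (simp add: equivp_reflp[OF tensor_rel_equivp] scaleC_add_right)
  show "(c + d) *\<^sub>C x = c *\<^sub>C x + d *\<^sub>C x" for c d and x :: "'a \<otimes> 'b"
    by transfer (simp add: equivp_reflp[OF tensor_rel_equivp] scaleC_add_left)
  show "c *\<^sub>C d *\<^sub>C x = (c * d) *\<^sub>C x" for c d and x :: "'a \<otimes> 'b"
    by transfer (simp add: equivp_reflp[OF tensor_rel_equivp] scaleC_scaleC)
  show "1 *\<^sub>C x = x" for x :: "'a \<otimes> 'b"
    by transfer (simp add: equivp_reflp[OF tensor_rel_equivp] scaleC_one)
qed

end

lift_definition tensor_of :: "'a::complex_vector \<Rightarrow> 'b::complex_vector \<Rightarrow> 'a \<otimes> 'b"  (infixl \<open>\<otimes>\<close> 70)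
  is "\<lambda>a b. Poly_Mapping.single (a, b) 1" .

lemma
  shows tensor_add_left: "(a + a') \<otimes> b = a \<otimes> b + a' \<otimes> b"
    and tensor_add_right: "a \<otimes> (b + b') = a \<otimes> b + a \<otimes> b'"
    and tensor_scale_left: "(c *\<^sub>C a) \<otimes> b = c *\<^sub>C (a \<otimes> b)"
    and tensor_scale_right: "a \<otimes> (c *\<^sub>C b) = c *\<^sub>C (a \<otimes> b)"
proof -
  show "(a + a') \<otimes> b = a \<otimes> b + a' \<otimes> b"
    by (transfer, unfold tensor_rel_def diff_diff_eq[symmetric], rule complex_vector.span_base,
        unfold tensor_relators_def, blast)
  show "a \<otimes> (b + b') = a \<otimes> b + a \<otimes> b'"
    by (transfer, unfold tensor_rel_def diff_diff_eq[symmetric], rule complex_vector.span_base,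
        unfold tensor_relators_def, blast)
  show "(c *\<^sub>C a) \<otimes> b = c *\<^sub>C (a \<otimes> b)"
    by (transfer, unfold tensor_rel_def, rule complex_vector.span_base,
        unfold tensor_relators_def, blast)
  show "a \<otimes> (c *\<^sub>C b) = c *\<^sub>C (a \<otimes> b)"
    by (transfer, unfold tensor_rel_def, rule complex_vector.span_base,
        unfold tensor_relators_def, blast)
qed

lemmas tensor_bilinear = tensor_add_left tensor_add_right tensor_scale_left tensor_scale_right

lemma clinear_tensor_of: "clinear (\<lambda>a. a \<otimes> b)" "clinear (\<lambda>b. a \<otimes> b)"
  by (simp_all add: clinear_iff tensor_bilinear)

definition free_lift :: "('k \<Rightarrow> 'c) \<Rightarrow> ('k \<Rightarrow>\<^sub>0 complex) \<Rightarrow> 'c::complex_vector"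
  where "free_lift h p = (\<Sum>k\<in>Poly_Mapping.keys p. Poly_Mapping.lookup p k *\<^sub>C h k)"

lemma free_lift_superset:
  assumes "finite K" "Poly_Mapping.keys p \<subseteq> K"
  shows "free_lift h p = (\<Sum>k\<in>K. Poly_Mapping.lookup p k *\<^sub>C h k)"
  unfolding free_lift_def using assms
  by (intro sum.mono_neutral_left) (auto simp: in_keys_iff)

lemma clinear_free_lift: "clinear (free_lift h)"
  unfolding clinear_iff
proof (intro conjI allI)
  fix p q :: "'a \<Rightarrow>\<^sub>0 complex" and c :: complex
  let ?K = "Poly_Mapping.keys p \<union> Poly_Mapping.keys q"
  have K: "finite ?K" "Poly_Mapping.keys (p + q) \<subseteq> ?K"
    using Poly_Mapping.keys_add[of p q] by auto
  show "free_lift h (p + q) = free_lift h p + free_lift h q"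
    using K by (simp add: free_lift_superset[of ?K] lookup_add scaleC_add_left sum.distrib)
  have "Poly_Mapping.keys (c *\<^sub>C p) \<subseteq> Poly_Mapping.keys p"
    by (auto simp: in_keys_iff)
  then show "free_lift h (c *\<^sub>C p) = c *\<^sub>C free_lift h p"
    by (simp add: free_lift_superset[of "Poly_Mapping.keys p"] complex_vector.scale_sum_right
        scaleC_scaleC)
qed

lemmas free_lift_add = clinear_free_lift[unfolded clinear_iff, THEN conjunct1, rule_format]
lemmas free_lift_scale = clinear_free_lift[unfolded clinear_iff, THEN conjunct2, rule_format]

lemma free_lift_single [simp]: "free_lift h (Poly_Mapping.single k 1) = h k"
  by (simp add: free_lift_def scaleC_one)

lemma free_lift_tensor_rel:
  assumes "cbilinear \<beta>" "tensor_rel p q"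
  shows "free_lift (case_prod \<beta>) p = free_lift (case_prod \<beta>) q"
proof -
  let ?f = "free_lift (case_prod \<beta>)"
  note lin = clinear_free_lift[of "case_prod \<beta>"]
  have diff: "?f (x - y) = ?f x - ?f y" for x y
    using lin by (rule Vector_Spaces.linear.axioms(3)[THEN module_hom.diff])
  have scale: "?f (c *\<^sub>C x) = c *\<^sub>C ?f x" for c x
    using lin by (simp add: clinear_iff)
  have "?f r = 0" if "r \<in> complex_vector.span tensor_relators" for r
    using that
  proof (induction rule: complex_vector.span_induct_alt)
    case base
    show ?case by (simp add: free_lift_def)
  next
    case (step c x y)
    have "?f x = 0"
      using step(1) assms(1)
      by (auto simp: tensor_relators_def diff scale cbilinear_def clinear_iff)
    then show ?case
      using lin step by (simp add: clinear_iff)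
  qed
  from this[of "p - q"] show ?thesis
    using assms(2) by (simp add: tensor_rel_def diff)
qed

text \<open>The linear map induced by a bilinear map; junk if \<open>\<beta>\<close> is not bilinear.\<close>

definition tensor_lift ::
    "('a::complex_vector \<Rightarrow> 'b::complex_vector \<Rightarrow> 'c::complex_vector) \<Rightarrow> 'a \<otimes> 'b \<Rightarrow> 'c"
  where "tensor_lift \<beta> = (THE f. clinear f \<and> (\<forall>a b. f (a \<otimes> b) = \<beta> a b))"

lemma free_decomp:
  "p = (\<Sum>k\<in>Poly_Mapping.keys p. Poly_Mapping.lookup p k *\<^sub>C Poly_Mapping.single k 1)"
  for p :: "'k \<Rightarrow>\<^sub>0 complex"
proof (rule poly_mapping_eqI)
  fix k
  have "Poly_Mapping.lookup p j * (if j = k then 1 else 0)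
      = (if j = k then Poly_Mapping.lookup p j else 0)" for j
    by simp
  then show "Poly_Mapping.lookup p k = Poly_Mapping.lookup
     (\<Sum>k\<in>Poly_Mapping.keys p. Poly_Mapping.lookup p k *\<^sub>C Poly_Mapping.single k 1) k"
    by (simp add: lookup_sum lookup_single when_def in_keys_iff)
qed

lemma tensor_induct [case_names zero add]:
  assumes "P 0" and "\<And>a b x. P x \<Longrightarrow> P (a \<otimes> b + x)"
  shows "P x"
proof -
  have "P (\<Sum>k\<in>K. c k *\<^sub>C (fst k \<otimes> snd k))" if "finite K" for K c
    using that
  proof induction
    case (insert k K)
    have "c k *\<^sub>C (fst k \<otimes> snd k) = (c k *\<^sub>C fst k) \<otimes> snd k"
      by (simp add: tensor_scale_left)
    then show ?case using insert assms(2) by simp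
  qed (simp add: assms(1))
  moreover have "x = (\<Sum>k\<in>Poly_Mapping.keys (rep_tensor x).
      Poly_Mapping.lookup (rep_tensor x) k *\<^sub>C (fst k \<otimes> snd k))"
  proof -
    have add: "abs_tensor (p + q) = abs_tensor p + abs_tensor q" for p q :: "'a \<times> 'b \<Rightarrow>\<^sub>0 complex"
      by (simp add: plus_tensor.abs_eq)
    have sum: "abs_tensor (\<Sum>k\<in>K. c k *\<^sub>C Poly_Mapping.single k 1)
        = (\<Sum>k\<in>K. c k *\<^sub>C (fst k \<otimes> snd k))"
      if "finite K" for K and c :: "'a \<times> 'b \<Rightarrow> complex"
      using that
      by induction (simp_all add: zero_tensor_def add tensor_of.abs_eq scaleC_tensor.abs_eq)
    have "x = abs_tensor (rep_tensor x)"
      by (simp add: Quotient_abs_rep[OF Quotient_tensor])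
    also have "\<dots> = abs_tensor (\<Sum>k\<in>Poly_Mapping.keys (rep_tensor x).
        Poly_Mapping.lookup (rep_tensor x) k *\<^sub>C Poly_Mapping.single k 1)"
      by (rule arg_cong[OF free_decomp])
    also have "\<dots> = (\<Sum>k\<in>Poly_Mapping.keys (rep_tensor x).
        Poly_Mapping.lookup (rep_tensor x) k *\<^sub>C (fst k \<otimes> snd k))"
      by (rule sum) simp
    finally show ?thesis .
  qed
  ultimately show ?thesis
    by (metis finite_keys)
qed

lemma clinear_tensor_ext:
  assumes "clinear f" "clinear g" "\<And>a b. f (a \<otimes> b) = g (a \<otimes> b)"
  shows "f = g"
proof
  fix x
  show "f x = g x"
  proof (induction x rule: tensor_induct)
    case zero
    have "f (0 *\<^sub>C 0) = g (0 *\<^sub>C 0)"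
      using assms(1,2) unfolding clinear_iff by (metis complex_vector.scale_zero_left)
    then show ?case by simp
  next
    case (add a b x)
    then show ?case using assms by (simp add: clinear_iff)
  qed
qed

theorem tensor_universal:
  assumes "cbilinear \<beta>"
  shows "\<exists>!f. clinear f \<and> (\<forall>a b. f (a \<otimes> b) = \<beta> a b)"
proof (rule ex_ex1I)
  define f where "f x = free_lift (case_prod \<beta>) (rep_tensor x)" for x
  have abs: "f (abs_tensor p) = free_lift (case_prod \<beta>) p" for p
    unfolding f_def
    by (rule free_lift_tensor_rel[OF assms])
      (simp add: Quotient_rep_abs[OF Quotient_tensor] equivp_reflp[OF tensor_rel_equivp])
  have abs_rep: "x = abs_tensor (rep_tensor x)" for x :: "'a \<otimes> 'b"
    by (simp add: Quotient_abs_rep[OF Quotient_tensor])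
  have "f (x + y) = f x + f y" for x y
  proof -
    have "f (abs_tensor p + abs_tensor q) = f (abs_tensor p) + f (abs_tensor q)" for p q
      by (simp add: plus_tensor.abs_eq abs free_lift_add)
    then show ?thesis by (metis abs_rep)
  qed
  moreover have "f (c *\<^sub>C x) = c *\<^sub>C f x" for c x
  proof -
    have "f (c *\<^sub>C abs_tensor p) = c *\<^sub>C f (abs_tensor p)" for p
      by (simp add: scaleC_tensor.abs_eq abs free_lift_scale)
    then show ?thesis by (metis abs_rep)
  qed
  moreover have "f (a \<otimes> b) = \<beta> a b" for a b
    by (simp add: tensor_of.abs_eq abs)
  ultimately show "\<exists>f. clinear f \<and> (\<forall>a b. f (a \<otimes> b) = \<beta> a b)"
    by (auto simp: clinear_iff)
qed (metis clinear_tensor_ext)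

lemma
  assumes "cbilinear \<beta>"
  shows clinear_tensor_lift: "clinear (tensor_lift \<beta>)"
    and tensor_lift_of: "tensor_lift \<beta> (a \<otimes> b) = \<beta> a b"
  using theI'[OF tensor_universal[OF assms]] by (auto simp: tensor_lift_def)

definition tensor_map ::
    "('a::complex_vector \<Rightarrow> 'c::complex_vector) \<Rightarrow> ('b::complex_vector \<Rightarrow> 'd::complex_vector)
      \<Rightarrow> 'a \<otimes> 'b \<Rightarrow> 'c \<otimes> 'd"  (infixr \<open>\<otimes>\<^sub>m\<close> 70)
  where "f \<otimes>\<^sub>m g = tensor_lift (\<lambda>a b. f a \<otimes> g b)"

lemma
  assumes "clinear f" "clinear g"
  shows clinear_tensor_map: "clinear (f \<otimes>\<^sub>m g)"
    and tensor_map_of: "(f \<otimes>\<^sub>m g) (a \<otimes> b) = f a \<otimes> g b"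
proof -
  have "cbilinear (\<lambda>a b. f a \<otimes> g b)"
    using assms by (simp add: cbilinear_def clinear_iff tensor_bilinear)
  then show "clinear (f \<otimes>\<^sub>m g)" "(f \<otimes>\<^sub>m g) (a \<otimes> b) = f a \<otimes> g b"
    unfolding tensor_map_def by (rule clinear_tensor_lift, rule tensor_lift_of)
qed

definition tensor_flip :: "'a::complex_vector \<otimes> 'b::complex_vector \<Rightarrow> 'b \<otimes> 'a"
  where "tensor_flip = tensor_lift (\<lambda>a b. b \<otimes> a)"

definition tensor_assoc ::
    "('a::complex_vector \<otimes> 'b::complex_vector) \<otimes> 'c::complex_vector \<Rightarrow> 'a \<otimes> ('b \<otimes> 'c)"
  where "tensor_assoc = tensor_lift (\<lambda>x c. (id \<otimes>\<^sub>m (\<lambda>b. b \<otimes> c)) x)"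

definition tensor_unassoc ::
    "'a::complex_vector \<otimes> ('b::complex_vector \<otimes> 'c::complex_vector) \<Rightarrow> ('a \<otimes> 'b) \<otimes> 'c"
  where "tensor_unassoc = tensor_lift (\<lambda>a x. ((\<lambda>b. a \<otimes> b) \<otimes>\<^sub>m id) x)"

text \<open>\<open>id \<otimes> \<tau> \<otimes> id\<close>, with the bracketing of fourfold tensors made explicit.\<close>

definition tensor_mid_flip ::
    "('a::complex_vector \<otimes> 'b::complex_vector) \<otimes> ('c::complex_vector \<otimes> 'd::complex_vector)
      \<Rightarrow> ('a \<otimes> 'c) \<otimes> ('b \<otimes> 'd)"
  where "tensor_mid_flip =
    tensor_unassoc \<circ> (id \<otimes>\<^sub>m (tensor_assoc \<circ> (tensor_flip \<otimes>\<^sub>m id) \<circ> tensor_unassoc)) \<circ> tensor_assoc"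

lemma
  shows clinear_tensor_flip: "clinear (tensor_flip :: 'a::complex_vector \<otimes> 'b::complex_vector \<Rightarrow> _)"
    and tensor_flip_of: "tensor_flip ((a::'a) \<otimes> (b::'b)) = b \<otimes> a"
proof -
  have "cbilinear (\<lambda>(a::'a) (b::'b). b \<otimes> a)"
    by (simp add: cbilinear_def clinear_tensor_of)
  then show "clinear (tensor_flip :: 'a \<otimes> 'b \<Rightarrow> _)" "tensor_flip (a \<otimes> b) = b \<otimes> a"
    unfolding tensor_flip_def by (rule clinear_tensor_lift, rule tensor_lift_of)
qed

lemma clinear_add: "clinear f \<Longrightarrow> clinear g \<Longrightarrow> clinear (\<lambda>x. f x + g x)"
  by (simp add: clinear_iff scaleC_add_right algebra_simps)

lemma clinear_0: "clinear f \<Longrightarrow> f 0 = 0"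
  by (metis clinear_iff complex_vector.scale_zero_left)

lemma cbilinear_tensorI:
  assumes lin: "\<And>c. clinear (\<lambda>x. \<beta> x c)" and pure: "\<And>a b. clinear (\<lambda>c. \<beta> (a \<otimes> b) c)"
  shows "cbilinear \<beta>" "cbilinear (\<lambda>c x. \<beta> x c)"
proof -
  have "clinear (\<beta> x)" for x
  proof (induction x rule: tensor_induct)
    case zero
    show ?case by (simp add: clinear_iff clinear_0[OF lin])
  next
    case (add a b x)
    have "\<beta> (a \<otimes> b + x) = (\<lambda>c. \<beta> (a \<otimes> b) c + \<beta> x c)"
      using lin by (simp add: clinear_iff fun_eq_iff)
    then show ?case using clinear_add[OF pure add] by simp
  qed
  with lin show "cbilinear \<beta>" "cbilinear (\<lambda>c x. \<beta> x c)" by (simp_all add: cbilinear_def)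
qed

lemma
  shows clinear_tensor_assoc: "clinear (tensor_assoc ::
      ('a::complex_vector \<otimes> 'b::complex_vector) \<otimes> 'c::complex_vector \<Rightarrow> _)"
    and tensor_assoc_of: "tensor_assoc (((a::'a) \<otimes> (b::'b)) \<otimes> (c::'c)) = a \<otimes> (b \<otimes> c)"
proof -
  have of: "(id \<otimes>\<^sub>m (\<lambda>b. b \<otimes> c)) (a \<otimes> b) = a \<otimes> (b \<otimes> c)" for a :: 'a and b :: 'b and c :: 'c
    unfolding tensor_map_of[OF clinear_id clinear_tensor_of(1)] by simp
  have bil: "cbilinear (\<lambda>(x::'a \<otimes> 'b) (c::'c). (id \<otimes>\<^sub>m (\<lambda>b. b \<otimes> c)) x)"
    by (rule cbilinear_tensorI(1), rule clinear_tensor_map[OF clinear_id clinear_tensor_of(1)],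
        unfold of) (simp add: clinear_iff tensor_bilinear)
  show "clinear (tensor_assoc :: ('a \<otimes> 'b) \<otimes> 'c \<Rightarrow> _)"
    unfolding tensor_assoc_def using bil by (rule clinear_tensor_lift)
  show "tensor_assoc ((a \<otimes> b) \<otimes> c) = a \<otimes> (b \<otimes> c)"
    unfolding tensor_assoc_def using tensor_lift_of[OF bil, of "a \<otimes> b" c] of by simp
qed

lemma
  shows clinear_tensor_unassoc: "clinear (tensor_unassoc ::
      'a::complex_vector \<otimes> ('b::complex_vector \<otimes> 'c::complex_vector) \<Rightarrow> _)"
    and tensor_unassoc_of: "tensor_unassoc ((a::'a) \<otimes> ((b::'b) \<otimes> (c::'c))) = (a \<otimes> b) \<otimes> c"
proof -
  have of: "((\<lambda>b. a \<otimes> b) \<otimes>\<^sub>m id) (b \<otimes> c) = (a \<otimes> b) \<otimes> c" for a :: 'a and b :: 'b and c :: 'c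
    unfolding tensor_map_of[OF clinear_tensor_of(2) clinear_id] by simp
  have bil: "cbilinear (\<lambda>(a::'a) (x::'b \<otimes> 'c). ((\<lambda>b. a \<otimes> b) \<otimes>\<^sub>m id) x)"
    by (rule cbilinear_tensorI(2), rule clinear_tensor_map[OF clinear_tensor_of(2) clinear_id],
        unfold of) (simp add: clinear_iff tensor_bilinear)
  show "clinear (tensor_unassoc :: 'a \<otimes> ('b \<otimes> 'c) \<Rightarrow> _)"
    unfolding tensor_unassoc_def using bil by (rule clinear_tensor_lift)
  show "tensor_unassoc (a \<otimes> (b \<otimes> c)) = (a \<otimes> b) \<otimes> c"
    unfolding tensor_unassoc_def using tensor_lift_of[OF bil, of a "b \<otimes> c"] of by simp
qed

lemma
  shows clinear_tensor_mid_flip: "clinear (tensor_mid_flip :: ('a::complex_vector \<otimes> 'b::complex_vector)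
      \<otimes> ('c::complex_vector \<otimes> 'd::complex_vector) \<Rightarrow> _)"
    and tensor_mid_flip_of:
      "tensor_mid_flip (((a::'a) \<otimes> (b::'b)) \<otimes> ((c::'c) \<otimes> (d::'d))) = (a \<otimes> c) \<otimes> (b \<otimes> d)"
  unfolding tensor_mid_flip_def
  by (intro clinear_compose clinear_tensor_map clinear_tensor_assoc clinear_tensor_unassoc
      clinear_tensor_flip clinear_id)
    (simp add: tensor_map_of tensor_assoc_of tensor_unassoc_of tensor_flip_of clinear_compose
      clinear_tensor_map clinear_tensor_assoc clinear_tensor_unassoc clinear_tensor_flip clinear_id)


section \<open>Algebras, coalgebras, Hopf algebras\<close>

locale unital_algebra =
  fixes \<mu> :: "'b::complex_vector \<otimes> 'b \<Rightarrow> 'b" and unit :: 'b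
  assumes mult_linear: "clinear \<mu>"
    and mult_assoc: "\<mu> \<circ> (\<mu> \<otimes>\<^sub>m id) = \<mu> \<circ> (id \<otimes>\<^sub>m \<mu>) \<circ> tensor_assoc"
    and unit_left: "\<mu> (unit \<otimes> a) = a"
    and unit_right: "\<mu> (a \<otimes> unit) = a"

text \<open>The canonical identifications of the tensor product with the ground field.\<close>

definition scalar_left :: "complex \<otimes> 'b::complex_vector \<Rightarrow> 'b"
  where "scalar_left = tensor_lift (\<lambda>c b. c *\<^sub>C b)"

definition scalar_right :: "'b::complex_vector \<otimes> complex \<Rightarrow> 'b"
  where "scalar_right = tensor_lift (\<lambda>b c. c *\<^sub>C b)"

definition scalar_mult :: "complex \<otimes> complex \<Rightarrow> complex"
  where "scalar_mult = tensor_lift (*)"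

lemma
  shows clinear_scalar_left: "clinear (scalar_left :: complex \<otimes> 'b::complex_vector \<Rightarrow> 'b)"
    and scalar_left_of: "scalar_left (c \<otimes> (b::'b)) = c *\<^sub>C b"
    and clinear_scalar_right: "clinear (scalar_right :: 'b \<otimes> complex \<Rightarrow> 'b)"
    and scalar_right_of: "scalar_right ((b::'b) \<otimes> c) = c *\<^sub>C b"
    and clinear_scalar_mult: "clinear scalar_mult"
    and scalar_mult_of: "scalar_mult (c \<otimes> d) = c * d"
proof -
  have "cbilinear (\<lambda>c (b::'b). c *\<^sub>C b)" "cbilinear (\<lambda>(b::'b) c. c *\<^sub>C b)"
    "cbilinear ((*) :: complex \<Rightarrow> complex \<Rightarrow> complex)"
    by (simp_all add: cbilinear_def clinear_iff scaleC_add_right scaleC_add_left scaleC_scaleC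
        algebra_simps)
  note this [THEN clinear_tensor_lift] this [THEN tensor_lift_of]
  then show "clinear (scalar_left :: complex \<otimes> 'b \<Rightarrow> 'b)" "scalar_left (c \<otimes> (b::'b)) = c *\<^sub>C b"
    "clinear (scalar_right :: 'b \<otimes> complex \<Rightarrow> 'b)" "scalar_right ((b::'b) \<otimes> c) = c *\<^sub>C b"
    "clinear scalar_mult" "scalar_mult (c \<otimes> d) = c * d"
    by (simp_all add: scalar_left_def scalar_right_def scalar_mult_def)
qed

locale coalgebra =
  fixes \<Delta> :: "'b::complex_vector \<Rightarrow> 'b \<otimes> 'b" and \<delta> :: "'b \<Rightarrow> complex"
  assumes comult_linear: "clinear \<Delta>"
    and counit_linear: "clinear \<delta>"
    and coassoc: "tensor_assoc \<circ> (\<Delta> \<otimes>\<^sub>m id) \<circ> \<Delta> = (id \<otimes>\<^sub>m \<Delta>) \<circ> \<Delta>"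
    and counit_left: "scalar_left \<circ> (\<delta> \<otimes>\<^sub>m id) \<circ> \<Delta> = id"
    and counit_right: "scalar_right \<circ> (id \<otimes>\<^sub>m \<delta>) \<circ> \<Delta> = id"

definition tensor_comult ::
    "('b::complex_vector \<Rightarrow> 'b \<otimes> 'b) \<Rightarrow> 'b \<otimes> 'b \<Rightarrow> ('b \<otimes> 'b) \<otimes> ('b \<otimes> 'b)"
  where "tensor_comult \<Delta> = tensor_mid_flip \<circ> (\<Delta> \<otimes>\<^sub>m \<Delta>)"

definition tensor_counit :: "('b::complex_vector \<Rightarrow> complex) \<Rightarrow> 'b \<otimes> 'b \<Rightarrow> complex"
  where "tensor_counit \<delta> = scalar_mult \<circ> (\<delta> \<otimes>\<^sub>m \<delta>)"

locale bialgebra = unital_algebra \<mu> unit + coalgebra \<Delta> \<delta>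
  for \<mu> :: "'b::complex_vector \<otimes> 'b \<Rightarrow> 'b" and unit :: 'b
    and \<Delta> :: "'b \<Rightarrow> 'b \<otimes> 'b" and \<delta> :: "'b \<Rightarrow> complex" +
  assumes comult_mult: "\<Delta> \<circ> \<mu> = (\<mu> \<otimes>\<^sub>m \<mu>) \<circ> tensor_comult \<Delta>"
    and comult_unit: "\<Delta> unit = unit \<otimes> unit"
    and counit_mult: "\<delta> \<circ> \<mu> = tensor_counit \<delta>"
    and counit_unit: "\<delta> unit = 1"

text \<open>\<open>\<mu>\<close> is not required to be the multiplication of a bialgebra with comultiplication \<open>\<Delta>\<close>, so
  that the same condition describes the antipode and the deformed antipodes.\<close>

definition is_antipode ::
    "('b::complex_vector \<otimes> 'b \<Rightarrow> 'b) \<Rightarrow> 'b \<Rightarrow> ('b \<Rightarrow> 'b \<otimes> 'b) \<Rightarrow> ('b \<Rightarrow> complex)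
      \<Rightarrow> ('b \<Rightarrow> 'b) \<Rightarrow> bool"
  where "is_antipode \<mu> unit \<Delta> \<delta> S \<longleftrightarrow> clinear S
    \<and> \<mu> \<circ> (S \<otimes>\<^sub>m id) \<circ> \<Delta> = (\<lambda>a. \<delta> a *\<^sub>C unit)
    \<and> \<mu> \<circ> (id \<otimes>\<^sub>m S) \<circ> \<Delta> = (\<lambda>a. \<delta> a *\<^sub>C unit)"

locale hopf_algebra = bialgebra \<mu> unit \<Delta> \<delta>
  for \<mu> :: "'b::complex_vector \<otimes> 'b \<Rightarrow> 'b" and unit :: 'b
    and \<Delta> :: "'b \<Rightarrow> 'b \<otimes> 'b" and \<delta> :: "'b \<Rightarrow> complex" +
  fixes S :: "'b \<Rightarrow> 'b"
  assumes antipode: "is_antipode \<mu> unit \<Delta> \<delta> S"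


section \<open>Convolution\<close>

text \<open>The product \<open>m\<close> is allowed to mix types, so that with \<^const>\<open>scalar_left\<close> and
  \<^const>\<open>scalar_right\<close> scalar-valued maps are convolved with vector-valued ones.\<close>

definition convolution ::
    "('c::complex_vector \<Rightarrow> 'c \<otimes> 'c) \<Rightarrow> ('x::complex_vector \<otimes> 'y::complex_vector \<Rightarrow> 'z::complex_vector)
      \<Rightarrow> ('c \<Rightarrow> 'x) \<Rightarrow> ('c \<Rightarrow> 'y) \<Rightarrow> 'c \<Rightarrow> 'z"
  where "convolution \<Delta> m R T = m \<circ> (R \<otimes>\<^sub>m T) \<circ> \<Delta>"

primrec conv_power ::
    "('c::complex_vector \<Rightarrow> 'c \<otimes> 'c) \<Rightarrow> ('c \<Rightarrow> complex) \<Rightarrow> ('c \<Rightarrow> complex) \<Rightarrow> nat \<Rightarrow> 'c \<Rightarrow> complex"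
  where
    "conv_power \<Delta> \<epsilon> f 0 = \<epsilon>"
  | "conv_power \<Delta> \<epsilon> f (Suc n) = convolution \<Delta> scalar_mult f (conv_power \<Delta> \<epsilon> f n)"

text \<open>For a linear functional on a coalgebra the series converges, because every element lies in a
  finite-dimensional subcoalgebra.\<close>

definition conv_exp ::
    "('c::complex_vector \<Rightarrow> 'c \<otimes> 'c) \<Rightarrow> ('c \<Rightarrow> complex) \<Rightarrow> ('c \<Rightarrow> complex) \<Rightarrow> 'c \<Rightarrow> complex"
  where "conv_exp \<Delta> \<epsilon> f x = suminf (\<lambda>n. conv_power \<Delta> \<epsilon> f n x / fact n)"


section \<open>Additive deformations\<close>

definition additive_deformation ::
    "('b::complex_vector \<otimes> 'b \<Rightarrow> 'b) \<Rightarrow> 'b \<Rightarrow> ('b \<Rightarrow> 'b \<otimes> 'b) \<Rightarrow> ('b \<Rightarrow> complex)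
      \<Rightarrow> (real \<Rightarrow> 'b \<otimes> 'b \<Rightarrow> 'b) \<Rightarrow> bool"
  where "additive_deformation \<mu> unit \<Delta> \<delta> M \<longleftrightarrow>
    (\<forall>t\<ge>0. unital_algebra (M t) unit)
    \<and> M 0 = \<mu>
    \<and> (\<forall>t\<ge>0. \<forall>s\<ge>0. \<Delta> \<circ> M (t + s) = (M t \<otimes>\<^sub>m M s) \<circ> tensor_comult \<Delta>)
    \<and> (\<forall>x. ((\<lambda>t. \<delta> (M t x)) \<longlongrightarrow> tensor_counit \<delta> x) (at_right 0))"

text \<open>The derivative is one-sided, an additive deformation being given on \<open>t \<ge> 0\<close> only.\<close>

definition is_generator ::
    "('b::complex_vector \<Rightarrow> complex) \<Rightarrow> (real \<Rightarrow> 'b \<otimes> 'b \<Rightarrow> 'b) \<Rightarrow> ('b \<otimes> 'b \<Rightarrow> complex) \<Rightarrow> bool"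
  where "is_generator \<delta> M L \<longleftrightarrow>
    (\<forall>x. ((\<lambda>t. \<delta> (M t x)) has_vector_derivative L x) (at 0 within {0..}))"

text \<open>\<open>\<mu> \<star> e\<^sub>\<star>\<^bsup>tL\<^esup>\<close>\<close>

definition deformed_mult ::
    "('b::complex_vector \<otimes> 'b \<Rightarrow> 'b) \<Rightarrow> ('b \<Rightarrow> 'b \<otimes> 'b) \<Rightarrow> ('b \<Rightarrow> complex)
      \<Rightarrow> ('b \<otimes> 'b \<Rightarrow> complex) \<Rightarrow> real \<Rightarrow> 'b \<otimes> 'b \<Rightarrow> 'b"
  where "deformed_mult \<mu> \<Delta> \<delta> L t =
    convolution (tensor_comult \<Delta>) scalar_right \<mu>
      (conv_exp (tensor_comult \<Delta>) (tensor_counit \<delta>) (\<lambda>x. of_real t * L x))"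

definition hopf_deformation ::
    "('b::complex_vector \<otimes> 'b \<Rightarrow> 'b) \<Rightarrow> 'b \<Rightarrow> ('b \<Rightarrow> 'b \<otimes> 'b) \<Rightarrow> ('b \<Rightarrow> complex)
      \<Rightarrow> (real \<Rightarrow> 'b \<otimes> 'b \<Rightarrow> 'b) \<Rightarrow> bool"
  where "hopf_deformation \<mu> unit \<Delta> \<delta> M \<longleftrightarrow> additive_deformation \<mu> unit \<Delta> \<delta> M
    \<and> (\<forall>t. \<exists>T. is_antipode (M t) unit \<Delta> \<delta> T)"

end

theory Submission
  imports Defs
begin

text \<open>
  In Sweedler notation, put \<open>f(a) = a\<^sub>1 \<otimes> S a\<^sub>2\<close> and \<open>g(a) = S a\<^sub>1 \<otimes> a\<^sub>2\<close>, fix \<open>t\<close>, and write \<open>K = t L\<close>,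
  \<open>\<kappa> = K \<circ> f = t \<sigma>\<close>, \<open>E = e\<^sub>\<star>\<^bsup>K\<^esup>\<close> and \<open>\<mu>\<^sub>t = \<mu> \<star> E\<close>. Since \<open>S\<close> reverses the comultiplication, the
  comultiplication of the tensor square sends \<open>f(a)\<close> to \<open>(a\<^sub>1 \<otimes> S a\<^sub>3) \<otimes> f(a\<^sub>2)\<close> and \<open>g(a)\<close> to
  \<open>g(a\<^sub>2) \<otimes> (S a\<^sub>1 \<otimes> a\<^sub>3)\<close>.

  The proof rests on three facts about \<open>K\<close>.

  \<^item> Evaluating \<open>\<mu> \<star> K = K \<star> \<mu>\<close> at \<open>f(a)\<close> gives \<open>a\<^sub>1 \<kappa>(a\<^sub>2) S a\<^sub>3 = \<kappa>(a) 1\<close>. Multiplication by one more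
    leg from the right turns this into \<open>a\<^sub>1 \<kappa>(a\<^sub>2) = \<kappa>(a\<^sub>1) a\<^sub>2\<close>: the functional \<open>\<kappa>\<close> is central for
    convolution, and so are its convolution powers and exponentials (\<open>\<kappa>_central\<close>, \<open>conv_central_exp\<close>).

  \<^item> The cocycle identity at \<open>a\<^sub>1 \<otimes> S a\<^sub>2 \<otimes> a\<^sub>3\<close>, together with \<open>L(1 \<otimes> a) = 0 = L(a \<otimes> 1)\<close>, yields
    \<open>K \<circ> g = K \<circ> f\<close> (\<open>generator_antipode_sym\<close>).

  \<^item> A central functional can be moved out of the middle of \<open>a\<^sub>1 \<otimes> S a\<^sub>3\<close> or \<open>S a\<^sub>1 \<otimes> a\<^sub>3\<close>. By induction
    \<open>K\<^bsup>\<star>n\<^esup> \<circ> f = \<kappa>\<^bsup>\<star>n\<^esup> = K\<^bsup>\<star>n\<^esup> \<circ> g\<close>, and therefore \<open>E \<circ> f = e\<^sub>\<star>\<^bsup>\<kappa>\<^esup> = E \<circ> g\<close>.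

  Hence \<open>\<mu>\<^sub>t(f(a)) = e\<^sub>\<star>\<^bsup>\<kappa>\<^esup>(a) 1 = \<mu>\<^sub>t(g(a))\<close>. The factor \<open>e\<^sub>\<star>\<^bsup>- \<kappa>\<^esup>\<close> in \<open>S\<^sub>t = S \<star> e\<^sub>\<star>\<^bsup>- \<kappa>\<^esup>\<close> cancels
  \<open>e\<^sub>\<star>\<^bsup>\<kappa>\<^esup>\<close>, which proves both antipode identities at once (\<open>is_antipode_exp\<close>).

  Two ingredients are needed around this argument. The exponential series has to converge absolutely,
  so that \<open>e\<^sub>\<star>\<^bsup>\<kappa>\<^esup> \<star> e\<^sub>\<star>\<^bsup>- \<kappa>\<^esup> = \<delta>\<close> is a Cauchy product; this follows because every element lies in a
  finite-dimensional space on which convolution powers are governed by powers of a matrix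
  (\<open>finite_comatrix\<close>). And the commutation, unit and cocycle properties of \<open>L\<close> have to be read off from
  the deformation by differentiating the axioms for \<open>\<mu>\<^sub>t\<close> at \<open>t = 0\<close>.
\<close>

section \<open>Sums over decompositions of a tensor\<close>

named_theorems clinear_intros

text \<open>As a rewrite rule this would also replace the unapplied scalar multiplication inside \<^const>\<open>clinear\<close>,
and linearity rules would then fail to match goals about scalar-valued maps.\<close>

declare scaleC_complex_def [simp del]

text \<open>Sweedler notation. A tensor is written as a fixed, arbitrarily chosen finite sum of pure tensors,
and \<open>\<beta>\<close> is summed over it. For bilinear \<open>\<beta>\<close> the result does not depend on the choice
(\<open>tensor_sum_eq_lift\<close>). Compared with \<^const>\<open>tensor_lift\<close>, the advantage is that a finite sum
commutes with linear maps, limits, derivatives and other such sums for every \<open>\<beta>\<close>, so that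
bilinearity is required only where it is really used.\<close>

definition tensor_sum ::
    "'a::complex_vector \<otimes> 'b::complex_vector \<Rightarrow> ('a \<Rightarrow> 'b \<Rightarrow> 'c) \<Rightarrow> 'c::comm_monoid_add"
  where "tensor_sum t \<beta> = (\<Sum>(x, y)\<leftarrow>(SOME xs. t = (\<Sum>(x, y)\<leftarrow>xs. x \<otimes> y)). \<beta> x y)"

syntax
  "_tensor_sum" :: "pttrn \<Rightarrow> pttrn \<Rightarrow> 'a \<Rightarrow> 'b \<Rightarrow> 'b"  (\<open>(3\<Sum>_ \<otimes> _ \<leftarrow> _./ _)\<close> [1000, 1000, 51, 10] 10)
translations
  "\<Sum>x \<otimes> y \<leftarrow> t. b" \<rightleftharpoons> "CONST tensor_sum t (\<lambda>x y. b)"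

lemma tensor_sum_pure: "(\<Sum>x \<otimes> y \<leftarrow> t. x \<otimes> y) = t"
proof -
  have "\<exists>xs. t = (\<Sum>(x, y)\<leftarrow>xs. x \<otimes> y)"
  proof (induction t rule: tensor_induct)
    case zero
    show ?case by (rule exI[of _ "[]"]) simp
  next
    case (add a b t)
    then obtain xs where "t = (\<Sum>(x, y)\<leftarrow>xs. x \<otimes> y)" by blast
    then show ?case by (intro exI[of _ "(a, b) # xs"]) simp
  qed
  from someI_ex[OF this] show ?thesis
    unfolding tensor_sum_def by simp
qed

lemma clinear_sum_list: "clinear F \<Longrightarrow> F (\<Sum>(x, y)\<leftarrow>xs. \<beta> x y) = (\<Sum>(x, y)\<leftarrow>xs. F (\<beta> x y))"
  by (induction xs) (auto simp: clinear_iff clinear_0)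

lemma clinear_tensor_sum: "clinear F \<Longrightarrow> F (\<Sum>x \<otimes> y \<leftarrow> t. \<beta> x y) = (\<Sum>x \<otimes> y \<leftarrow> t. F (\<beta> x y))"
  unfolding tensor_sum_def by (rule clinear_sum_list)

lemma clinear_eq_tensor_sum: "clinear F \<Longrightarrow> F t = (\<Sum>x \<otimes> y \<leftarrow> t. F (x \<otimes> y))"
  using clinear_tensor_sum[of F t "\<lambda>x y. x \<otimes> y"] by (simp add: tensor_sum_pure)

lemma tensor_sum_eq_lift:
  assumes "\<And>y. clinear (\<lambda>x. \<beta> x y)" "\<And>x. clinear (\<beta> x)"
  shows "(\<Sum>x \<otimes> y \<leftarrow> t. \<beta> x y) = tensor_lift \<beta> t"
proof -
  have bil: "cbilinear \<beta>" using assms by (simp add: cbilinear_def)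
  show ?thesis
    using clinear_eq_tensor_sum[OF clinear_tensor_lift[OF bil], of t]
    by (simp add: tensor_lift_of[OF bil])
qed

lemma tensor_sum_tensor_of:
  assumes "\<And>y. clinear (\<lambda>x. \<beta> x y)" "\<And>x. clinear (\<beta> x)"
  shows "(\<Sum>x \<otimes> y \<leftarrow> a \<otimes> b. \<beta> x y) = \<beta> a b"
  using assms by (simp add: tensor_sum_eq_lift tensor_lift_of cbilinear_def)

lemma clinear_ident [clinear_intros]: "clinear (\<lambda>x. x)"
  by (simp add: clinear_iff)

text \<open>Composition is not itself among the linearity rules: with a variable outer map it would apply to
every goal. Each particular linear map contributes its own instance instead.\<close>

lemma clinear_comp: "clinear g \<Longrightarrow> clinear f \<Longrightarrow> clinear (\<lambda>x. g (f x))"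
  by (simp add: clinear_iff)

lemma
  assumes "clinear f"
  shows clinear_tensor_left [clinear_intros]: "clinear (\<lambda>x. f x \<otimes> b)"
    and clinear_tensor_right [clinear_intros]: "clinear (\<lambda>x. b \<otimes> f x)"
  using assms by (simp_all add: clinear_iff tensor_bilinear)

lemma clinear_scaleC_right [clinear_intros]: "clinear f \<Longrightarrow> clinear (\<lambda>x. c *\<^sub>C f x)"
  by (simp add: clinear_iff scaleC_add_right scaleC_scaleC mult.commute)

lemma clinear_scaleC_left [clinear_intros]: "clinear f \<Longrightarrow> clinear (\<lambda>x. f x *\<^sub>C b)"
  by (simp add: clinear_iff scaleC_add_left scaleC_scaleC scaleC_complex_def)

lemma clinear_mult_right [clinear_intros]: "clinear f \<Longrightarrow> clinear (\<lambda>x. c * f x :: complex)"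
  by (simp add: clinear_iff scaleC_complex_def algebra_simps)

lemma clinear_mult_left [clinear_intros]: "clinear f \<Longrightarrow> clinear (\<lambda>x. f x * c :: complex)"
  by (simp add: clinear_iff scaleC_complex_def algebra_simps)

lemma clinear_tensor_sum_left [clinear_intros]:
  assumes "\<And>y. clinear (\<lambda>x. \<beta> x y)" "\<And>x. clinear (\<beta> x)" "clinear f"
  shows "clinear (\<lambda>a. \<Sum>x \<otimes> y \<leftarrow> f a. \<beta> x y)"
proof -
  have "clinear (tensor_lift \<beta>)"
    using assms by (intro clinear_tensor_lift) (simp add: cbilinear_def)
  then have "clinear (\<lambda>a. tensor_lift \<beta> (f a))"
    using assms(3) by (simp add: clinear_iff)
  then show ?thesis using assms by (simp add: tensor_sum_eq_lift)
qed

lemma clinear_sum_list_right: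
  assumes "\<And>x y. clinear (\<lambda>a. \<beta> a x y)"
  shows "clinear (\<lambda>a. \<Sum>(x, y)\<leftarrow>xs. \<beta> a x y)"
proof (induction xs)
  case (Cons p xs)
  then show ?case
    using assms[of "fst p" "snd p"] by (simp add: case_prod_beta clinear_add)
qed (simp add: clinear_iff)

lemma clinear_tensor_sum_right [clinear_intros]:
  assumes "\<And>x y. clinear (\<lambda>a. \<beta> a x y)"
  shows "clinear (\<lambda>a. \<Sum>x \<otimes> y \<leftarrow> t. \<beta> a x y)"
  unfolding tensor_sum_def by (rule clinear_sum_list_right) (rule assms)

lemma clinear_tensor_map_comp [clinear_intros]: "clinear f \<Longrightarrow> clinear g \<Longrightarrow> clinear h \<Longrightarrow> clinear (\<lambda>x. (f \<otimes>\<^sub>m g) (h x))"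
  using clinear_tensor_map[of f g] by (simp add: clinear_iff)

lemma tensor_sum_swap:
  "(\<Sum>x \<otimes> y \<leftarrow> s. \<Sum>u \<otimes> v \<leftarrow> t. \<beta> x y u v) = (\<Sum>u \<otimes> v \<leftarrow> t. \<Sum>x \<otimes> y \<leftarrow> s. \<beta> x y u v)"
proof -
  have "(\<Sum>(x, y)\<leftarrow>xs. \<Sum>(u, v)\<leftarrow>ys. \<beta> x y u v) = (\<Sum>(u, v)\<leftarrow>ys. \<Sum>(x, y)\<leftarrow>xs. \<beta> x y u v)" for xs ys
  proof (induction xs)
    case (Cons p xs)
    then show ?case by (simp add: case_prod_beta sum_list_addf)
  qed (simp add: case_prod_beta)
  then show ?thesis by (simp add: tensor_sum_def)
qed

lemma scaleC_tensor_sum: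
  "c *\<^sub>C (\<Sum>x \<otimes> y \<leftarrow> t. \<beta> x y) = (\<Sum>x \<otimes> y \<leftarrow> t. c *\<^sub>C \<beta> x y)"
  by (rule clinear_tensor_sum) (intro clinear_intros)

lemma mult_tensor_sum:
  "c * (\<Sum>x \<otimes> y \<leftarrow> t. \<beta> x y) = (\<Sum>x \<otimes> y \<leftarrow> t. c * \<beta> x y :: complex)"
  by (rule clinear_tensor_sum) (intro clinear_intros)

lemma tensor_sum_mult:
  "(\<Sum>x \<otimes> y \<leftarrow> t. \<beta> x y) * c = (\<Sum>x \<otimes> y \<leftarrow> t. \<beta> x y * c :: complex)"
  by (rule clinear_tensor_sum) (intro clinear_intros)

lemma tensor_sum_scaleC:
  "(\<Sum>x \<otimes> y \<leftarrow> t. \<beta> x y) *\<^sub>C b = (\<Sum>x \<otimes> y \<leftarrow> t. \<beta> x y *\<^sub>C b)"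
  by (rule clinear_tensor_sum) (intro clinear_intros)

lemma tensor_sum_tensor_map:
  assumes "clinear f" "clinear g" "\<And>y. clinear (\<lambda>x. \<beta> x y)" "\<And>x. clinear (\<beta> x)"
  shows "(\<Sum>x \<otimes> y \<leftarrow> (f \<otimes>\<^sub>m g) t. \<beta> x y) = (\<Sum>x \<otimes> y \<leftarrow> t. \<beta> (f x) (g y))"
proof -
  have "clinear (\<lambda>t. \<Sum>x \<otimes> y \<leftarrow> (f \<otimes>\<^sub>m g) t. \<beta> x y)"
    by (intro clinear_intros assms)
  then show ?thesis
    using assms by (subst clinear_eq_tensor_sum) (simp_all add: tensor_map_of tensor_sum_tensor_of)
qed

lemma tensor_sum_comp:
  assumes "\<And>y. clinear (\<lambda>x. \<beta> x y)" "\<And>x. clinear (\<beta> x)"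
  shows "(\<Sum>x \<otimes> y \<leftarrow> (\<Sum>u \<otimes> v \<leftarrow> t. \<gamma> u v). \<beta> x y) = (\<Sum>u \<otimes> v \<leftarrow> t. \<Sum>x \<otimes> y \<leftarrow> \<gamma> u v. \<beta> x y)"
  by (rule clinear_tensor_sum) (intro clinear_intros assms)

lemma tensor_sum_sum:
  "(\<Sum>x \<otimes> y \<leftarrow> t. \<Sum>i\<in>I. \<beta> i x y) = (\<Sum>i\<in>I. \<Sum>x \<otimes> y \<leftarrow> t. \<beta> i x y)"
proof -
  have "(\<Sum>(x, y)\<leftarrow>xs. \<Sum>i\<in>I. \<beta> i x y) = (\<Sum>i\<in>I. \<Sum>(x, y)\<leftarrow>xs. \<beta> i x y)" for xs
    by (induction xs) (auto simp: sum.distrib)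
  then show ?thesis by (simp add: tensor_sum_def)
qed

lemma tensor_sum_sums:
  fixes \<beta> :: "nat \<Rightarrow> 'a::complex_vector \<Rightarrow> 'b::complex_vector \<Rightarrow> complex"
  assumes "\<And>x y. (\<lambda>n. \<beta> n x y) sums \<gamma> x y"
  shows "(\<lambda>n. \<Sum>x \<otimes> y \<leftarrow> t. \<beta> n x y) sums (\<Sum>x \<otimes> y \<leftarrow> t. \<gamma> x y)"
proof -
  have "(\<lambda>n. \<Sum>(x, y)\<leftarrow>xs. \<beta> n x y) sums (\<Sum>(x, y)\<leftarrow>xs. \<gamma> x y)" for xs
    by (induction xs) (auto intro!: sums_add assms)
  then show ?thesis by (simp add: tensor_sum_def)
qed

lemma tensor_sum_add:
  "(\<Sum>x \<otimes> y \<leftarrow> t. \<beta> x y + \<gamma> x y) = (\<Sum>x \<otimes> y \<leftarrow> t. \<beta> x y) + (\<Sum>x \<otimes> y \<leftarrow> t. \<gamma> x y)"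
proof -
  have "(\<Sum>(x, y)\<leftarrow>xs. \<beta> x y + \<gamma> x y) = (\<Sum>(x, y)\<leftarrow>xs. \<beta> x y) + (\<Sum>(x, y)\<leftarrow>xs. \<gamma> x y)" for xs
    by (induction xs) (auto simp: algebra_simps)
  then show ?thesis by (simp add: tensor_sum_def)
qed

lemma tensor_sum_0 [simp]: "(\<Sum>x \<otimes> y \<leftarrow> t. 0) = 0"
proof -
  have "(\<Sum>(x, y)\<leftarrow>xs. 0) = 0" for xs :: "('b \<times> 'c) list"
    by (induction xs) auto
  then show ?thesis by (simp add: tensor_sum_def)
qed

lemma has_vector_derivative_tensor_sum:
  assumes "\<And>x y. (\<beta> x y has_vector_derivative \<beta>' x y) F"
  shows "((\<lambda>s. \<Sum>x \<otimes> y \<leftarrow> t. \<beta> x y s) has_vector_derivative (\<Sum>x \<otimes> y \<leftarrow> t. \<beta>' x y)) F"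
proof -
  have "((\<lambda>s. \<Sum>(x, y)\<leftarrow>xs. \<beta> x y s) has_vector_derivative (\<Sum>(x, y)\<leftarrow>xs. \<beta>' x y)) F" for xs
    by (induction xs) (auto intro!: has_vector_derivative_add assms)
  then show ?thesis by (simp add: tensor_sum_def)
qed

section \<open>Bases and linear functionals\<close>

text \<open>Coordinates with respect to a basis are linear functionals; they are used to separate vectors and to
split off the first leg of a tensor.\<close>

lemma clinear_representation:
  assumes "complex_vector.independent B" "complex_vector.span B = UNIV"
  shows "clinear (\<lambda>v. complex_vector.representation B v b)"
  using assms by (simp add: clinear_iff complex_vector.representation_add complex_vector.representation_scale scaleC_complex_def)

lemma complex_basis_exists:
  obtains B :: "'a::complex_vector set"
  where "complex_vector.independent B" "complex_vector.span B = UNIV"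
proof
  show "complex_vector.independent (complex_vector.extend_basis ({} :: 'a set))"
    by (intro complex_vector.independent_extend_basis complex_vector.independent_empty)
  show "complex_vector.span (complex_vector.extend_basis ({} :: 'a set)) = UNIV"
    by (intro complex_vector.span_extend_basis complex_vector.independent_empty)
qed

text \<open>Vector-valued identities that involve limits are tested on functionals, since the vector space
carries no topology.\<close>

lemma functionals_separate:
  fixes u v :: "'a::complex_vector"
  assumes "\<And>\<psi>. clinear \<psi> \<Longrightarrow> \<psi> u = (\<psi> v :: complex)"
  shows "u = v"
proof -
  obtain B :: "'a set" where B: "complex_vector.independent B" "complex_vector.span B = UNIV"
    by (rule complex_basis_exists)
  have "complex_vector.representation B u = complex_vector.representation B v"
    using assms[OF clinear_representation[OF B]] by blast
  moreover have "w = (\<Sum>b | complex_vector.representation B w b \<noteq> 0.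
      complex_vector.representation B w b *\<^sub>C b)" for w
    by (rule complex_vector.sum_nonzero_representation_eq[symmetric]) (simp_all add: B)
  ultimately show ?thesis by metis
qed

lemma clinear_sum: "clinear f \<Longrightarrow> f (\<Sum>i\<in>I. v i) = (\<Sum>i\<in>I. f (v i))"
  by (induction I rule: infinite_finite_induct) (simp_all add: clinear_0, simp add: clinear_iff)

lemma tensor_basis_expansion:
  fixes t :: "'a::complex_vector \<otimes> 'b::complex_vector"
  assumes B: "complex_vector.independent B" "complex_vector.span B = UNIV"
  obtains F v where "finite F" "F \<subseteq> B" "t = (\<Sum>e\<in>F. e \<otimes> v e)"
proof -
  have "\<exists>F v. finite F \<and> F \<subseteq> B \<and> t = (\<Sum>e\<in>F. e \<otimes> v e)"
  proof (induction t rule: tensor_induct)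
    case zero
    show ?case by (rule exI[of _ "{}"]) simp
  next
    case (add a b t)
    then obtain F v where F: "finite F" "F \<subseteq> B" "t = (\<Sum>e\<in>F. e \<otimes> v e)" by blast
    \<comment> \<open>The coordinates \<open>r e\<close> of \<open>a\<close> are moved across the tensor sign onto \<open>b\<close>.\<close>
    define r where "r = complex_vector.representation B a"
    define G where "G = {e. r e \<noteq> 0}"
    have G: "finite G" "G \<subseteq> B"
      using complex_vector.finite_representation[of B a] complex_vector.representation_ne_zero[of B a]
      by (auto simp: G_def r_def)
    have "a = (\<Sum>e\<in>G. r e *\<^sub>C e)"
      using complex_vector.sum_nonzero_representation_eq[of B a] B by (simp add: G_def r_def)
    also have "\<dots> = (\<Sum>e\<in>F \<union> G. r e *\<^sub>C e)"
      using F G by (intro sum.mono_neutral_left) (auto simp: G_def)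
    finally have "a \<otimes> b = (\<Sum>e\<in>F \<union> G. e \<otimes> (r e *\<^sub>C b))"
      using clinear_sum[OF clinear_tensor_of(1)[of b], of "\<lambda>e. r e *\<^sub>C e" "F \<union> G"]
      by (simp add: tensor_bilinear)
    moreover have "t = (\<Sum>e\<in>F \<union> G. e \<otimes> (if e \<in> F then v e else 0))"
      using F G clinear_0[OF clinear_tensor_of(2)]
      by (auto intro!: sum.mono_neutral_cong_left)
    ultimately have "a \<otimes> b + t = (\<Sum>e\<in>F \<union> G. e \<otimes> (r e *\<^sub>C b + (if e \<in> F then v e else 0)))"
      by (simp add: sum.distrib tensor_add_right)
    then show ?case
      using F G
      by (intro exI[of _ "F \<union> G"] exI[of _ "\<lambda>e. r e *\<^sub>C b + (if e \<in> F then v e else 0)"]) simp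
  qed
  then show ?thesis using that by blast
qed

lemma tensor_sum_expansion:
  assumes "t = (\<Sum>e\<in>I. p e \<otimes> q e)"
    and "\<And>y. clinear (\<lambda>x. \<beta> x y)" "\<And>x. clinear (\<beta> x)"
  shows "(\<Sum>x \<otimes> y \<leftarrow> t. \<beta> x y) = (\<Sum>e\<in>I. \<beta> (p e) (q e))"
proof -
  have "clinear (\<lambda>t. \<Sum>x \<otimes> y \<leftarrow> t. \<beta> x y)"
    by (intro clinear_intros assms)
  from clinear_sum[OF this, of "\<lambda>e. p e \<otimes> q e" I] show ?thesis
    unfolding assms(1) using assms(2,3) by (simp add: tensor_sum_tensor_of)
qed

section \<open>Convolution on a coalgebra\<close>

context coalgebra
begin

lemma clinear_comult [clinear_intros]: "clinear f \<Longrightarrow> clinear (\<lambda>x. \<Delta> (f x))"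
  using comult_linear by (rule clinear_comp)

lemma clinear_counit [clinear_intros]: "clinear f \<Longrightarrow> clinear (\<lambda>x. \<delta> (f x))"
  using counit_linear by (rule clinear_comp)

text \<open>Coassociativity as it is used in Sweedler calculations: both sides are the value of the trilinear
map \<open>\<beta>\<close> at the threefold comultiplication of \<open>a\<close>.\<close>

lemma coassoc_sum:
  assumes "\<And>y z. clinear (\<lambda>x. \<beta> x y z)" "\<And>x z. clinear (\<lambda>y. \<beta> x y z)" "\<And>x y. clinear (\<beta> x y)"
  shows "(\<Sum>u \<otimes> z \<leftarrow> \<Delta> a. \<Sum>x \<otimes> y \<leftarrow> \<Delta> u. \<beta> x y z) = (\<Sum>x \<otimes> u \<leftarrow> \<Delta> a. \<Sum>y \<otimes> z \<leftarrow> \<Delta> u. \<beta> x y z)"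
proof -
  define F where "F t = (\<Sum>x \<otimes> u \<leftarrow> t. \<Sum>y \<otimes> z \<leftarrow> u. \<beta> x y z)" for t
  have F: "clinear F" unfolding F_def by (intro clinear_intros assms)
  have F': "F (tensor_assoc s) = (\<Sum>u \<otimes> z \<leftarrow> s. \<Sum>x \<otimes> y \<leftarrow> u. \<beta> x y z)" (is "_ = ?G s") for s
  proof -
    have "F \<circ> tensor_assoc = ?G"
    proof (rule clinear_tensor_ext)
      show "clinear (F \<circ> tensor_assoc)"
        by (rule clinear_compose[OF clinear_tensor_assoc F])
      show "clinear ?G" by (intro clinear_intros assms)
      fix u and z :: 'b
      have "(F \<circ> tensor_assoc) (u \<otimes> z) = (\<Sum>x \<otimes> y \<leftarrow> u. F (tensor_assoc ((x \<otimes> y) \<otimes> z)))"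
        unfolding o_def
        by (rule clinear_eq_tensor_sum) (intro clinear_comp[OF F] clinear_comp[OF clinear_tensor_assoc] clinear_intros)
      also have "\<dots> = (\<Sum>x \<otimes> y \<leftarrow> u. \<beta> x y z)"
        by (simp add: tensor_assoc_of F_def tensor_sum_tensor_of assms clinear_intros)
      also have "\<dots> = ?G (u \<otimes> z)"
        by (simp add: tensor_sum_tensor_of assms clinear_intros)
      finally show "(F \<circ> tensor_assoc) (u \<otimes> z) = ?G (u \<otimes> z)" .
    qed
    then show ?thesis by (simp add: fun_eq_iff)
  qed
  have "(\<Sum>u \<otimes> z \<leftarrow> \<Delta> a. \<Sum>x \<otimes> y \<leftarrow> \<Delta> u. \<beta> x y z) = F (tensor_assoc ((\<Delta> \<otimes>\<^sub>m id) (\<Delta> a)))"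
    by (simp add: F' tensor_sum_tensor_map comult_linear clinear_id clinear_intros assms)
  also have "\<dots> = F ((id \<otimes>\<^sub>m \<Delta>) (\<Delta> a))"
    using coassoc by (simp add: fun_eq_iff)
  also have "\<dots> = (\<Sum>x \<otimes> u \<leftarrow> \<Delta> a. \<Sum>y \<otimes> z \<leftarrow> \<Delta> u. \<beta> x y z)"
    by (simp add: F_def tensor_sum_tensor_map comult_linear clinear_id clinear_intros assms)
  finally show ?thesis .
qed

lemma counit_left_sum:
  assumes "clinear f"
  shows "(\<Sum>x \<otimes> y \<leftarrow> \<Delta> a. \<delta> x *\<^sub>C f y) = f a"
proof -
  have "a = scalar_left ((\<delta> \<otimes>\<^sub>m id) (\<Delta> a))"
    using counit_left by (simp add: fun_eq_iff)
  also have "\<dots> = (\<Sum>x \<otimes> y \<leftarrow> \<Delta> a. \<delta> x *\<^sub>C y)"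
    by (subst clinear_eq_tensor_sum[of "\<lambda>t. scalar_left ((\<delta> \<otimes>\<^sub>m id) t)"])
      (intro clinear_comp[OF clinear_scalar_left] clinear_tensor_map counit_linear clinear_id,
        simp add: counit_linear clinear_id tensor_map_of scalar_left_of)
  finally have "f a = f (\<Sum>x \<otimes> y \<leftarrow> \<Delta> a. \<delta> x *\<^sub>C y)" by simp
  then show ?thesis
    using assms by (simp add: clinear_tensor_sum[OF assms] clinear_iff)
qed

lemma counit_right_sum:
  assumes "clinear f"
  shows "(\<Sum>x \<otimes> y \<leftarrow> \<Delta> a. \<delta> y *\<^sub>C f x) = f a"
proof -
  have "a = scalar_right ((id \<otimes>\<^sub>m \<delta>) (\<Delta> a))"
    using counit_right by (simp add: fun_eq_iff)
  also have "\<dots> = (\<Sum>x \<otimes> y \<leftarrow> \<Delta> a. \<delta> y *\<^sub>C x)"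
    by (subst clinear_eq_tensor_sum[of "\<lambda>t. scalar_right ((id \<otimes>\<^sub>m \<delta>) t)"])
      (intro clinear_comp[OF clinear_scalar_right] clinear_tensor_map counit_linear clinear_id,
        simp add: counit_linear clinear_id tensor_map_of scalar_right_of)
  finally have "f a = f (\<Sum>x \<otimes> y \<leftarrow> \<Delta> a. \<delta> y *\<^sub>C x)" by simp
  then show ?thesis
    using assms by (simp add: clinear_tensor_sum[OF assms] clinear_iff)
qed

text \<open>The local finiteness of coalgebras. Write \<open>\<Delta> x = \<Sum>\<^sub>i e\<^sub>i \<otimes> v\<^sub>i\<close> with the \<open>e\<^sub>i\<close> from a basis. Applying the
coordinate functional of \<open>e\<^sub>j\<close> to the first leg of \<open>(\<Delta> \<otimes> id) \<Delta> x = (id \<otimes> \<Delta>) \<Delta> x\<close> shows that \<open>\<Delta> v\<^sub>j\<close>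
is again a combination of the \<open>v\<^sub>i\<close> in its second leg. The index set \<open>I\<close> consists of the basis vectors
themselves.\<close>

lemma finite_comatrix:
  obtains I :: "'b set" and v d
  where "finite I" "\<And>j. j \<in> I \<Longrightarrow> \<Delta> (v j) = (\<Sum>i\<in>I. d j i \<otimes> v i)" "x = (\<Sum>i\<in>I. \<delta> i *\<^sub>C v i)"
proof -
  obtain B :: "'b set" where B: "complex_vector.independent B" "complex_vector.span B = UNIV"
    by (rule complex_basis_exists)
  obtain I v where I: "finite I" "I \<subseteq> B" "\<Delta> x = (\<Sum>e\<in>I. e \<otimes> v e)"
    by (rule tensor_basis_expansion[OF B])
  define c where "c j u = complex_vector.representation B u j" for j u
  have c: "clinear (c j)" for j
    unfolding c_def by (rule clinear_representation[OF B])
  have c_basis: "c j e = (if j = e then 1 else 0)" if "e \<in> I" for j e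
    using that I(2) complex_vector.representation_basis[OF B(1)] by (auto simp: c_def)
  define d where "d j i = (\<Sum>u \<otimes> w \<leftarrow> \<Delta> i. c j u *\<^sub>C w)" for j i
  have "\<Delta> (v j) = (\<Sum>i\<in>I. d j i \<otimes> v i)" if "j \<in> I" for j
  proof -
    have "\<Delta> (v j) = (\<Sum>e\<in>I. c j e *\<^sub>C \<Delta> (v e))"
    proof -
      have "(\<Sum>e\<in>I. c j e *\<^sub>C \<Delta> (v e)) = (\<Sum>e\<in>I. if j = e then \<Delta> (v e) else 0)"
        by (rule sum.cong) (simp_all add: c_basis scaleC_one)
      then show ?thesis using I(1) \<open>j \<in> I\<close> by simp
    qed
    also have "\<dots> = (\<Sum>u \<otimes> w \<leftarrow> \<Delta> x. c j u *\<^sub>C \<Delta> w)"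
      by (rule tensor_sum_expansion[OF I(3), symmetric]) (intro clinear_intros c)+
    also have "\<dots> = (\<Sum>u \<otimes> w \<leftarrow> \<Delta> x. \<Sum>p \<otimes> q \<leftarrow> \<Delta> w. c j u *\<^sub>C (p \<otimes> q))"
      by (simp add: tensor_sum_pure flip: scaleC_tensor_sum)
    also have "\<dots> = (\<Sum>w \<otimes> q \<leftarrow> \<Delta> x. \<Sum>u \<otimes> p \<leftarrow> \<Delta> w. c j u *\<^sub>C (p \<otimes> q))"
      by (rule coassoc_sum[symmetric]) (intro clinear_intros c)+
    also have "\<dots> = (\<Sum>e\<in>I. \<Sum>u \<otimes> p \<leftarrow> \<Delta> e. c j u *\<^sub>C (p \<otimes> v e))"
      by (rule tensor_sum_expansion[OF I(3)]) (intro clinear_intros c)+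
    also have "\<dots> = (\<Sum>i\<in>I. d j i \<otimes> v i)"
      unfolding d_def
      by (simp add: clinear_tensor_sum[OF clinear_tensor_of(1)] tensor_bilinear)
    finally show ?thesis .
  qed
  moreover have "x = (\<Sum>i\<in>I. \<delta> i *\<^sub>C v i)"
  proof -
    have "x = (\<Sum>u \<otimes> w \<leftarrow> \<Delta> x. \<delta> u *\<^sub>C w)"
      by (rule counit_left_sum[symmetric]) (rule clinear_ident)
    also have "\<dots> = (\<Sum>i\<in>I. \<delta> i *\<^sub>C v i)"
      by (rule tensor_sum_expansion[OF I(3)]) (intro clinear_intros)+
    finally show ?thesis .
  qed
  ultimately show ?thesis using I(1) that by blast
qed

lemma convolution_sum:
  assumes "clinear m" "clinear R" "clinear T"
  shows "convolution \<Delta> m R T a = (\<Sum>x \<otimes> y \<leftarrow> \<Delta> a. m (R x \<otimes> T y))"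
proof -
  have "clinear (\<lambda>t. m ((R \<otimes>\<^sub>m T) t))"
    by (intro clinear_comp[OF assms(1)] clinear_tensor_map assms)
  from clinear_eq_tensor_sum[OF this, of "\<Delta> a"] show ?thesis
    using assms by (simp add: convolution_def tensor_map_of)
qed

lemma clinear_conv_power: "clinear f \<Longrightarrow> clinear (conv_power \<Delta> \<delta> f n)"
proof (induction n)
  case (Suc n)
  then show ?case
    unfolding conv_power.simps convolution_def
    by (intro clinear_compose clinear_tensor_map comult_linear clinear_scalar_mult) simp_all
qed (simp add: counit_linear)

lemma conv_power_Suc_sum:
  assumes "clinear f"
  shows "conv_power \<Delta> \<delta> f (Suc n) a = (\<Sum>x \<otimes> y \<leftarrow> \<Delta> a. f x * conv_power \<Delta> \<delta> f n y)"
  using assms by (simp add: convolution_sum clinear_conv_power clinear_scalar_mult scalar_mult_of)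

lemma conv_power_add:
  assumes f: "clinear f"
  shows "(\<Sum>x \<otimes> y \<leftarrow> \<Delta> a. conv_power \<Delta> \<delta> f m x * conv_power \<Delta> \<delta> f n y) = conv_power \<Delta> \<delta> f (m + n) a"
proof (induction m arbitrary: a)
  case 0
  show ?case
    using counit_left_sum[OF clinear_conv_power[OF f], of a n] by (simp add: scaleC_complex_def)
next
  case (Suc m)
  note [clinear_intros] = clinear_conv_power[OF f]
  let ?p = "conv_power \<Delta> \<delta> f"
  have "(\<Sum>x \<otimes> y \<leftarrow> \<Delta> a. ?p (Suc m) x * ?p n y)
      = (\<Sum>w \<otimes> z \<leftarrow> \<Delta> a. \<Sum>x \<otimes> y \<leftarrow> \<Delta> w. f x * ?p m y * ?p n z)"
    by (simp only: conv_power_Suc_sum[OF f] tensor_sum_mult)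
  also have "\<dots> = (\<Sum>x \<otimes> w \<leftarrow> \<Delta> a. \<Sum>y \<otimes> z \<leftarrow> \<Delta> w. f x * ?p m y * ?p n z)"
    by (rule coassoc_sum) (intro clinear_intros f)+
  also have "\<dots> = (\<Sum>x \<otimes> w \<leftarrow> \<Delta> a. f x * ?p (m + n) w)"
    by (simp only: mult.assoc Suc.IH flip: mult_tensor_sum)
  also have "\<dots> = ?p (Suc m + n) a"
    by (simp only: conv_power_Suc_sum[OF f] add_Suc)
  finally show ?case .
qed

text \<open>On the \<open>v\<^sub>j\<close> of \<open>finite_comatrix\<close> one more convolution factor \<open>f\<close> acts as the matrix \<open>f(d\<^sub>j\<^sub>i)\<close>, so
the powers grow at most geometrically. As \<open>K\<close> it suffices to take the sum of all absolute values of
entries, a crude bound for the row sums.\<close>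

lemma conv_power_bound:
  assumes f: "clinear f"
  obtains C K where "0 \<le> C" "0 \<le> K" "\<And>n. norm (conv_power \<Delta> \<delta> f n x) \<le> C * K ^ n"
proof -
  let ?p = "conv_power \<Delta> \<delta> f"
  obtain I v d where I: "finite I" "\<And>j. j \<in> I \<Longrightarrow> \<Delta> (v j) = (\<Sum>i\<in>I. d j i \<otimes> v i)"
    and x: "x = (\<Sum>i\<in>I. \<delta> i *\<^sub>C v i)"
    using finite_comatrix[of x] by blast
  define C where "C = (\<Sum>j\<in>I. norm (\<delta> (v j)))"
  define K where "K = (\<Sum>j\<in>I. \<Sum>i\<in>I. norm (f (d j i)))"
  have pos: "0 \<le> C" "0 \<le> K" by (simp_all add: C_def K_def sum_nonneg)
  have bound: "norm (?p n (v j)) \<le> C * K ^ n" if "j \<in> I" for n j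
    using that
  proof (induction n arbitrary: j)
    case 0
    then show ?case
      unfolding C_def using I(1) by (auto intro: member_le_sum)
  next
    case (Suc n)
    have "?p (Suc n) (v j) = (\<Sum>i\<in>I. f (d j i) * ?p n (v i))"
      unfolding conv_power_Suc_sum[OF f]
      by (rule tensor_sum_expansion[OF I(2)[OF Suc.prems]]) (intro clinear_intros f clinear_conv_power[OF f])+
    also have "norm \<dots> \<le> (\<Sum>i\<in>I. norm (f (d j i)) * (C * K ^ n))"
      by (rule sum_norm_le) (auto simp: norm_mult intro!: mult_left_mono Suc.IH)
    also have "\<dots> = (\<Sum>i\<in>I. norm (f (d j i))) * (C * K ^ n)"
      by (simp add: sum_distrib_right)
    also have "\<dots> \<le> K * (C * K ^ n)"
      unfolding K_def using Suc.prems I(1) pos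
      by (intro mult_right_mono member_le_sum[of j I "\<lambda>j. \<Sum>i\<in>I. norm (f (d j i))"])
        (auto simp: sum_nonneg K_def)
    finally show ?case by (simp add: mult.left_commute)
  qed
  have "norm (?p n x) \<le> (\<Sum>i\<in>I. norm (\<delta> i)) * C * K ^ n" for n
  proof -
    have "?p n x = (\<Sum>i\<in>I. \<delta> i * ?p n (v i))"
      using clinear_conv_power[OF f, of n]
      by (simp add: x clinear_sum[OF clinear_conv_power[OF f]] clinear_iff scaleC_complex_def)
    also have "norm \<dots> \<le> (\<Sum>i\<in>I. norm (\<delta> i) * (C * K ^ n))"
      by (rule sum_norm_le) (auto simp: norm_mult intro!: mult_left_mono bound)
    finally show ?thesis by (simp add: sum_distrib_right mult.assoc)
  qed
  then show ?thesis
    using that[of "(\<Sum>i\<in>I. norm (\<delta> i)) * C" K] pos by (simp add: sum_nonneg)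
qed

lemma summable_norm_conv_exp:
  assumes f: "clinear f"
  shows "summable (\<lambda>n. norm (conv_power \<Delta> \<delta> f n x / fact n))"
proof -
  obtain C K where b: "0 \<le> C" "0 \<le> K" "\<And>n. norm (conv_power \<Delta> \<delta> f n x) \<le> C * K ^ n"
    using conv_power_bound[OF f] by blast
  have "summable (\<lambda>n. C * (inverse (fact n) * K ^ n))"
    by (intro summable_mult summable_exp)
  then show ?thesis
  proof (rule summable_comparison_test')
    fix n :: nat
    show "norm (norm (conv_power \<Delta> \<delta> f n x / fact n)) \<le> C * (inverse (fact n) * K ^ n)"
      using b(3)[of n] by (simp add: norm_divide field_simps)
  qed
qed

lemma conv_exp_sums:
  "clinear f \<Longrightarrow> (\<lambda>n. conv_power \<Delta> \<delta> f n x / fact n) sums conv_exp \<Delta> \<delta> f x"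
  unfolding conv_exp_def
  by (intro summable_sums summable_norm_cancel[OF summable_norm_conv_exp])

lemma conv_power_uminus:
  assumes f: "clinear f"
  shows "conv_power \<Delta> \<delta> (\<lambda>a. - f a) n a = (- 1) ^ n * conv_power \<Delta> \<delta> f n a"
proof (induction n arbitrary: a)
  case (Suc n)
  have g: "clinear (\<lambda>a. - f a)"
    using f by (simp add: clinear_iff)
  have "conv_power \<Delta> \<delta> (\<lambda>a. - f a) (Suc n) a
      = (\<Sum>x \<otimes> y \<leftarrow> \<Delta> a. (- 1) ^ Suc n * (f x * conv_power \<Delta> \<delta> f n y))"
    unfolding conv_power_Suc_sum[OF g] by (simp add: Suc.IH mult.left_commute)
  then show ?case
    by (simp only: conv_power_Suc_sum[OF f] mult_tensor_sum)
qed simp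

lemma clinear_conv_exp:
  assumes f: "clinear f"
  shows "clinear (conv_exp \<Delta> \<delta> f)"
  unfolding clinear_iff
proof (intro conjI allI)
  fix x y c
  note p = clinear_conv_power[OF f, unfolded clinear_iff]
  note s = conv_exp_sums[OF f]
  have "(\<lambda>n. conv_power \<Delta> \<delta> f n (x + y) / fact n) sums (conv_exp \<Delta> \<delta> f x + conv_exp \<Delta> \<delta> f y)"
    using sums_add[OF s[of x] s[of y]] p by (simp add: add_divide_distrib)
  then show "conv_exp \<Delta> \<delta> f (x + y) = conv_exp \<Delta> \<delta> f x + conv_exp \<Delta> \<delta> f y"
    by (rule sums_unique2[OF s])
  have "(\<lambda>n. conv_power \<Delta> \<delta> f n (c *\<^sub>C x) / fact n) sums (c * conv_exp \<Delta> \<delta> f x)"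
    using sums_mult[OF s[of x], of c] p by (simp add: scaleC_complex_def)
  then show "conv_exp \<Delta> \<delta> f (c *\<^sub>C x) = c *\<^sub>C conv_exp \<Delta> \<delta> f x"
    using sums_unique2[OF s] by (simp add: scaleC_complex_def)
qed

text \<open>By absolute convergence the sum over \<open>\<Delta> a\<close> of the products of series is a Cauchy product. Its
\<open>n\<close>-th term is \<open>(1 - 1)\<^sup>n / n!\<close> times the \<open>n\<close>-th convolution power of \<open>f\<close>, so only \<open>n = 0\<close> remains.\<close>

lemma conv_exp_uminus:
  assumes f: "clinear f"
  shows "(\<Sum>x \<otimes> y \<leftarrow> \<Delta> a. conv_exp \<Delta> \<delta> f x * conv_exp \<Delta> \<delta> (\<lambda>a. - f a) y) = \<delta> a"
proof -
  let ?p = "conv_power \<Delta> \<delta> f" and ?q = "conv_power \<Delta> \<delta> (\<lambda>a. - f a)"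
  have g: "clinear (\<lambda>a. - f a)"
    using f by (simp add: clinear_iff)
  define c where "c n = (\<Sum>x \<otimes> y \<leftarrow> \<Delta> a. \<Sum>i\<le>n. ?p i x / fact i * (?q (n - i) y / fact (n - i)))" for n
  have "c sums (\<Sum>x \<otimes> y \<leftarrow> \<Delta> a. conv_exp \<Delta> \<delta> f x * conv_exp \<Delta> \<delta> (\<lambda>a. - f a) y)"
    unfolding c_def
    by (rule tensor_sum_sums, unfold conv_exp_def, rule Cauchy_product_sums)
      (rule summable_norm_conv_exp f g)+
  moreover have "c n = (if n = 0 then \<delta> a else 0)" for n
  proof -
    have summand: "?p i x / fact i * (?q (n - i) y / fact (n - i))
        = of_nat (n choose i) * 1 ^ i * (- 1) ^ (n - i) / fact n * (?p i x * ?p (n - i) y)" if "i \<le> n" for i x y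
      using that by (simp add: conv_power_uminus[OF f] binomial_fact field_simps)
    have "c n = (\<Sum>i\<le>n. \<Sum>x \<otimes> y \<leftarrow> \<Delta> a. of_nat (n choose i) * 1 ^ i * (- 1) ^ (n - i) / fact n * (?p i x * ?p (n - i) y))"
      unfolding c_def tensor_sum_sum[symmetric] using summand by simp
    also have "\<dots> = (\<Sum>i\<le>n. of_nat (n choose i) * 1 ^ i * (- 1) ^ (n - i)) / fact n * ?p n a"
      unfolding mult_tensor_sum[symmetric] conv_power_add[OF f] sum_divide_distrib sum_distrib_right
      by (rule sum.cong) simp_all
    also have "\<dots> = (1 + (- 1)) ^ n / fact n * ?p n a"
      by (simp only: binomial_ring)
    finally show ?thesis by (simp add: power_0_left)
  qed
  then have "c = (\<lambda>n. if n = 0 then \<delta> a else 0)"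
    by (rule ext)
  ultimately show ?thesis
    using sums_single[of 0 "\<lambda>_. \<delta> a"] by (metis sums_unique2)
qed

text \<open>The identity \<open>a\<^sub>1 f(a\<^sub>2) = f(a\<^sub>1) a\<^sub>2\<close> says that \<open>f\<close> commutes under convolution with the identity map,
and hence with every linear map (\<open>conv_centralD\<close>).\<close>

definition conv_central :: "('b \<Rightarrow> complex) \<Rightarrow> bool"
  where "conv_central f \<longleftrightarrow> (\<forall>a. (\<Sum>x \<otimes> y \<leftarrow> \<Delta> a. f y *\<^sub>C x) = (\<Sum>x \<otimes> y \<leftarrow> \<Delta> a. f x *\<^sub>C y))"

lemma conv_centralD:
  assumes "conv_central f" "clinear g"
  shows "(\<Sum>x \<otimes> y \<leftarrow> \<Delta> a. f y *\<^sub>C g x) = (\<Sum>x \<otimes> y \<leftarrow> \<Delta> a. f x *\<^sub>C g y)"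
proof -
  have "g (\<Sum>x \<otimes> y \<leftarrow> \<Delta> a. f y *\<^sub>C x) = g (\<Sum>x \<otimes> y \<leftarrow> \<Delta> a. f x *\<^sub>C y)"
    using assms(1) by (simp add: conv_central_def)
  then show ?thesis
    using assms(2) by (simp add: clinear_tensor_sum[OF assms(2)] clinear_iff)
qed

lemma conv_central_uminus:
  assumes "conv_central f"
  shows "conv_central (\<lambda>a. - f a)"
proof -
  have neg: "(- f x) *\<^sub>C y = (- 1) *\<^sub>C f x *\<^sub>C y" for x y :: 'b
    by (simp add: scaleC_scaleC)
  have "(\<Sum>x \<otimes> y \<leftarrow> \<Delta> a. (- f y) *\<^sub>C x) = (\<Sum>x \<otimes> y \<leftarrow> \<Delta> a. (- f x) *\<^sub>C y)" for a
    using assms unfolding conv_central_def neg scaleC_tensor_sum[symmetric] by simp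
  then show ?thesis by (simp add: conv_central_def)
qed

text \<open>The factors \<open>f\<close> and \<open>f\<^bsup>\<star>n\<^esup>\<close> are moved past \<open>x\<close> one after the other, with coassociativity regrouping the
legs in between.\<close>

lemma conv_central_power:
  assumes f: "clinear f" and "conv_central f"
  shows "conv_central (conv_power \<Delta> \<delta> f n)"
proof (induction n)
  case 0
  show ?case
    by (simp add: conv_central_def counit_left_sum counit_right_sum clinear_ident)
next
  case (Suc n)
  let ?p = "conv_power \<Delta> \<delta> f"
  note p = clinear_conv_power[OF f]
  show ?case
    unfolding conv_central_def
  proof
    fix a
    have "(\<Sum>x \<otimes> w \<leftarrow> \<Delta> a. ?p (Suc n) w *\<^sub>C x)
        = (\<Sum>x \<otimes> w \<leftarrow> \<Delta> a. \<Sum>y \<otimes> z \<leftarrow> \<Delta> w. (f y * ?p n z) *\<^sub>C x)"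
      by (simp only: conv_power_Suc_sum[OF f] tensor_sum_scaleC)
    also have "\<dots> = (\<Sum>w \<otimes> z \<leftarrow> \<Delta> a. \<Sum>x \<otimes> y \<leftarrow> \<Delta> w. (f y * ?p n z) *\<^sub>C x)"
      by (rule coassoc_sum[symmetric]) (intro clinear_intros f p)+
    also have "\<dots> = (\<Sum>w \<otimes> z \<leftarrow> \<Delta> a. ?p n z *\<^sub>C (\<Sum>x \<otimes> y \<leftarrow> \<Delta> w. f y *\<^sub>C x))"
      by (simp add: scaleC_tensor_sum scaleC_scaleC mult.commute)
    also have "\<dots> = (\<Sum>w \<otimes> z \<leftarrow> \<Delta> a. ?p n z *\<^sub>C (\<Sum>x \<otimes> y \<leftarrow> \<Delta> w. f x *\<^sub>C y))"
      using \<open>conv_central f\<close> by (simp add: conv_central_def)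
    also have "\<dots> = (\<Sum>w \<otimes> z \<leftarrow> \<Delta> a. \<Sum>x \<otimes> y \<leftarrow> \<Delta> w. f x *\<^sub>C ?p n z *\<^sub>C y)"
      by (simp add: scaleC_tensor_sum scaleC_scaleC mult.commute)
    also have "\<dots> = (\<Sum>x \<otimes> w \<leftarrow> \<Delta> a. \<Sum>y \<otimes> z \<leftarrow> \<Delta> w. f x *\<^sub>C ?p n z *\<^sub>C y)"
      by (rule coassoc_sum) (intro clinear_intros f p)+
    also have "\<dots> = (\<Sum>x \<otimes> w \<leftarrow> \<Delta> a. f x *\<^sub>C (\<Sum>y \<otimes> z \<leftarrow> \<Delta> w. ?p n z *\<^sub>C y))"
      by (simp add: scaleC_tensor_sum)
    also have "\<dots> = (\<Sum>x \<otimes> w \<leftarrow> \<Delta> a. f x *\<^sub>C (\<Sum>y \<otimes> z \<leftarrow> \<Delta> w. ?p n y *\<^sub>C z))"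
      using Suc.IH by (simp add: conv_central_def)
    also have "\<dots> = (\<Sum>x \<otimes> w \<leftarrow> \<Delta> a. \<Sum>y \<otimes> z \<leftarrow> \<Delta> w. (f x * ?p n y) *\<^sub>C z)"
      by (simp add: scaleC_tensor_sum scaleC_scaleC)
    also have "\<dots> = (\<Sum>w \<otimes> z \<leftarrow> \<Delta> a. \<Sum>x \<otimes> y \<leftarrow> \<Delta> w. (f x * ?p n y) *\<^sub>C z)"
      by (rule coassoc_sum[symmetric]) (intro clinear_intros f p)+
    also have "\<dots> = (\<Sum>w \<otimes> z \<leftarrow> \<Delta> a. ?p (Suc n) w *\<^sub>C z)"
      by (simp only: conv_power_Suc_sum[OF f] tensor_sum_scaleC)
    finally show "(\<Sum>x \<otimes> w \<leftarrow> \<Delta> a. ?p (Suc n) w *\<^sub>C x) = (\<Sum>w \<otimes> z \<leftarrow> \<Delta> a. ?p (Suc n) w *\<^sub>C z)" .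
  qed
qed

lemma conv_central_exp:
  assumes f: "clinear f" and "conv_central f"
  shows "conv_central (conv_exp \<Delta> \<delta> f)"
  unfolding conv_central_def
proof (rule allI, rule functionals_separate)
  fix a and \<psi> :: "'b \<Rightarrow> complex"
  assume \<psi>: "clinear \<psi>"
  let ?p = "conv_power \<Delta> \<delta> f" and ?e = "conv_exp \<Delta> \<delta> f"
  have s1: "(\<lambda>n. \<Sum>x \<otimes> y \<leftarrow> \<Delta> a. ?p n y / fact n * \<psi> x) sums (\<Sum>x \<otimes> y \<leftarrow> \<Delta> a. ?e y * \<psi> x)"
    by (intro tensor_sum_sums sums_mult2 conv_exp_sums f)
  have s2: "(\<lambda>n. \<Sum>x \<otimes> y \<leftarrow> \<Delta> a. ?p n x / fact n * \<psi> y) sums (\<Sum>x \<otimes> y \<leftarrow> \<Delta> a. ?e x * \<psi> y)"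
    by (intro tensor_sum_sums sums_mult2 conv_exp_sums f)
  have eq: "(\<Sum>x \<otimes> y \<leftarrow> \<Delta> a. ?p n y / fact n * \<psi> x) = (\<Sum>x \<otimes> y \<leftarrow> \<Delta> a. ?p n x / fact n * \<psi> y)" for n
  proof -
    have "(\<Sum>x \<otimes> y \<leftarrow> \<Delta> a. ?p n y * \<psi> x) = (\<Sum>x \<otimes> y \<leftarrow> \<Delta> a. ?p n x * \<psi> y)"
      using conv_centralD[OF conv_central_power[OF assms] \<psi>] by (simp only: scaleC_complex_def)
    then have "inverse (fact n) * (\<Sum>x \<otimes> y \<leftarrow> \<Delta> a. ?p n y * \<psi> x)
        = inverse (fact n) * (\<Sum>x \<otimes> y \<leftarrow> \<Delta> a. ?p n x * \<psi> y)" by (rule arg_cong)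
    then show ?thesis
      by (simp only: mult_tensor_sum divide_inverse mult_ac)
  qed
  have "(\<Sum>x \<otimes> y \<leftarrow> \<Delta> a. ?e y * \<psi> x) = (\<Sum>x \<otimes> y \<leftarrow> \<Delta> a. ?e x * \<psi> y)"
    using s1 unfolding eq by (rule sums_unique2[OF _ s2])
  then show "\<psi> (\<Sum>x \<otimes> y \<leftarrow> \<Delta> a. ?e y *\<^sub>C x) = \<psi> (\<Sum>x \<otimes> y \<leftarrow> \<Delta> a. ?e x *\<^sub>C y)"
    using \<psi> by (simp add: clinear_tensor_sum[OF \<psi>] clinear_iff scaleC_complex_def)
qed

text \<open>A central functional applied to the middle leg of \<open>a\<^sub>1 \<otimes> a\<^sub>2 \<otimes> a\<^sub>3\<close> can be moved to the first leg,
which leaves \<open>\<beta>\<close> on two neighbouring legs. Comultiplying \<open>a\<^sub>1 \<otimes> S a\<^sub>2\<close> and \<open>S a\<^sub>1 \<otimes> a\<^sub>2\<close> produces sums of this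
shape.\<close>

lemma conv_central_middle:
  assumes g: "clinear g" "conv_central g"
    and \<beta>: "\<And>y. clinear (\<lambda>x. \<beta> x y)" "\<And>x. clinear (\<beta> x)"
  shows "(\<Sum>x \<otimes> r \<leftarrow> \<Delta> a. \<Sum>w \<otimes> y \<leftarrow> \<Delta> r. g w *\<^sub>C \<beta> x y)
    = (\<Sum>w \<otimes> r \<leftarrow> \<Delta> a. g w *\<^sub>C (\<Sum>x \<otimes> y \<leftarrow> \<Delta> r. \<beta> x y))"
proof -
  have "(\<Sum>x \<otimes> r \<leftarrow> \<Delta> a. \<Sum>w \<otimes> y \<leftarrow> \<Delta> r. g w *\<^sub>C \<beta> x y)
      = (\<Sum>r \<otimes> y \<leftarrow> \<Delta> a. \<Sum>x \<otimes> w \<leftarrow> \<Delta> r. g w *\<^sub>C \<beta> x y)"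
    by (rule coassoc_sum[symmetric]) (intro clinear_intros g \<beta>)+
  also have "\<dots> = (\<Sum>r \<otimes> y \<leftarrow> \<Delta> a. \<Sum>w \<otimes> x \<leftarrow> \<Delta> r. g w *\<^sub>C \<beta> x y)"
    by (simp only: conv_centralD[OF g(2) \<beta>(1)])
  also have "\<dots> = (\<Sum>w \<otimes> r \<leftarrow> \<Delta> a. \<Sum>x \<otimes> y \<leftarrow> \<Delta> r. g w *\<^sub>C \<beta> x y)"
    by (rule coassoc_sum) (intro clinear_intros g \<beta>)+
  finally show ?thesis by (simp only: scaleC_tensor_sum)
qed

end

section \<open>The tensor square of a coalgebra\<close>

context coalgebra
begin

lemma clinear_tensor_comult: "clinear (tensor_comult \<Delta>)"
  unfolding tensor_comult_def
  by (intro clinear_compose clinear_tensor_map comult_linear clinear_tensor_mid_flip)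

lemma clinear_tensor_counit: "clinear (tensor_counit \<delta>)"
  unfolding tensor_counit_def
  by (intro clinear_compose clinear_tensor_map counit_linear clinear_scalar_mult)

lemma tensor_counit_of: "tensor_counit \<delta> (a \<otimes> b) = \<delta> a * \<delta> b"
  by (simp add: tensor_counit_def tensor_map_of counit_linear scalar_mult_of)

lemma tensor_comult_of:
  "tensor_comult \<Delta> (a \<otimes> b) = (\<Sum>a1 \<otimes> a2 \<leftarrow> \<Delta> a. \<Sum>b1 \<otimes> b2 \<leftarrow> \<Delta> b. (a1 \<otimes> b1) \<otimes> (a2 \<otimes> b2))"
proof -
  have "tensor_comult \<Delta> (a \<otimes> b) = tensor_mid_flip (\<Delta> a \<otimes> \<Delta> b)"
    by (simp add: tensor_comult_def tensor_map_of comult_linear)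
  also have "\<dots> = (\<Sum>a1 \<otimes> a2 \<leftarrow> \<Delta> a. tensor_mid_flip ((a1 \<otimes> a2) \<otimes> \<Delta> b))"
    by (rule clinear_eq_tensor_sum) (intro clinear_comp[OF clinear_tensor_mid_flip] clinear_intros)
  also have "\<dots> = (\<Sum>a1 \<otimes> a2 \<leftarrow> \<Delta> a. \<Sum>b1 \<otimes> b2 \<leftarrow> \<Delta> b. tensor_mid_flip ((a1 \<otimes> a2) \<otimes> (b1 \<otimes> b2)))"
  proof -
    have "tensor_mid_flip ((a1 \<otimes> a2) \<otimes> \<Delta> b)
        = (\<Sum>b1 \<otimes> b2 \<leftarrow> \<Delta> b. tensor_mid_flip ((a1 \<otimes> a2) \<otimes> (b1 \<otimes> b2)))" for a1 a2 :: 'b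
      by (rule clinear_eq_tensor_sum) (intro clinear_comp[OF clinear_tensor_mid_flip] clinear_intros)
    then show ?thesis by simp
  qed
  finally show ?thesis by (simp only: tensor_mid_flip_of)
qed

lemma tensor_comult_sum:
  assumes "\<And>y. clinear (\<lambda>x. \<beta> x y)" "\<And>x. clinear (\<beta> x)"
  shows "(\<Sum>p \<otimes> q \<leftarrow> tensor_comult \<Delta> (a \<otimes> b). \<beta> p q)
    = (\<Sum>a1 \<otimes> a2 \<leftarrow> \<Delta> a. \<Sum>b1 \<otimes> b2 \<leftarrow> \<Delta> b. \<beta> (a1 \<otimes> b1) (a2 \<otimes> b2))"
  unfolding tensor_comult_of using assms by (simp add: tensor_sum_comp tensor_sum_tensor_of)

text \<open>The tensor square is a coalgebra, so the results on convolution exponentials apply to functionals on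
it as well. Coassociativity on \<open>a \<otimes> b\<close> is that of \<open>a\<close> and that of \<open>b\<close>, after the sums
over \<open>\<Delta> a\<close> and \<open>\<Delta> b\<close> have been interchanged.\<close>

lemma tensor_coalgebra: "coalgebra (tensor_comult \<Delta>) (tensor_counit \<delta>)"
proof (rule coalgebra.intro)
  note [clinear_intros] = clinear_comp[OF clinear_tensor_comult] clinear_comp[OF clinear_tensor_counit]
    clinear_comp[OF clinear_tensor_assoc]
  show "clinear (tensor_comult \<Delta>)" by (rule clinear_tensor_comult)
  show "clinear (tensor_counit \<delta>)" by (rule clinear_tensor_counit)
  show "tensor_assoc \<circ> (tensor_comult \<Delta> \<otimes>\<^sub>m id) \<circ> tensor_comult \<Delta>
      = (id \<otimes>\<^sub>m tensor_comult \<Delta>) \<circ> tensor_comult \<Delta>"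
  proof (rule clinear_tensor_ext)
    show "clinear (tensor_assoc \<circ> (tensor_comult \<Delta> \<otimes>\<^sub>m id) \<circ> tensor_comult \<Delta>)"
      "clinear ((id \<otimes>\<^sub>m tensor_comult \<Delta>) \<circ> tensor_comult \<Delta>)"
      by (intro clinear_compose clinear_tensor_assoc clinear_tensor_map clinear_tensor_comult clinear_id)+
    fix a b
    have "(tensor_assoc \<circ> (tensor_comult \<Delta> \<otimes>\<^sub>m id) \<circ> tensor_comult \<Delta>) (a \<otimes> b)
      = (\<Sum>a1 \<otimes> a2 \<leftarrow> \<Delta> a. \<Sum>b1 \<otimes> b2 \<leftarrow> \<Delta> b. tensor_assoc (tensor_comult \<Delta> (a1 \<otimes> b1) \<otimes> (a2 \<otimes> b2)))"
    proof -
      have "(tensor_assoc \<circ> (tensor_comult \<Delta> \<otimes>\<^sub>m id) \<circ> tensor_comult \<Delta>) (a \<otimes> b)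
        = (\<Sum>p \<otimes> q \<leftarrow> tensor_comult \<Delta> (a \<otimes> b). tensor_assoc (tensor_comult \<Delta> p \<otimes> q))"
        unfolding o_def
        by (subst clinear_eq_tensor_sum[of "\<lambda>t. tensor_assoc ((tensor_comult \<Delta> \<otimes>\<^sub>m id) t)"])
          (intro clinear_intros clinear_tensor_comult clinear_id,
            simp add: tensor_map_of clinear_tensor_comult clinear_id)
      also have "\<dots> = (\<Sum>a1 \<otimes> a2 \<leftarrow> \<Delta> a. \<Sum>b1 \<otimes> b2 \<leftarrow> \<Delta> b. tensor_assoc (tensor_comult \<Delta> (a1 \<otimes> b1) \<otimes> (a2 \<otimes> b2)))"
        by (rule tensor_comult_sum) (intro clinear_intros)+
      finally show ?thesis .
    qed
    also have "\<dots> = (\<Sum>a1 \<otimes> z \<leftarrow> \<Delta> a. \<Sum>b1 \<otimes> w \<leftarrow> \<Delta> b. \<Sum>x \<otimes> y \<leftarrow> \<Delta> a1. \<Sum>u \<otimes> v \<leftarrow> \<Delta> b1.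
        (x \<otimes> u) \<otimes> ((y \<otimes> v) \<otimes> (z \<otimes> w)))"
      unfolding tensor_comult_of clinear_tensor_sum[OF clinear_tensor_of(1)]
        clinear_tensor_sum[OF clinear_tensor_assoc] tensor_assoc_of ..
    also have "\<dots> = (\<Sum>a1 \<otimes> z \<leftarrow> \<Delta> a. \<Sum>x \<otimes> y \<leftarrow> \<Delta> a1. \<Sum>b1 \<otimes> w \<leftarrow> \<Delta> b. \<Sum>u \<otimes> v \<leftarrow> \<Delta> b1.
        (x \<otimes> u) \<otimes> ((y \<otimes> v) \<otimes> (z \<otimes> w)))"
      by (subst tensor_sum_swap[where s = "\<Delta> b"]) (rule refl)
    also have "\<dots> = (\<Sum>a1 \<otimes> z \<leftarrow> \<Delta> a. \<Sum>x \<otimes> y \<leftarrow> \<Delta> a1. \<Sum>u \<otimes> b2 \<leftarrow> \<Delta> b. \<Sum>v \<otimes> w \<leftarrow> \<Delta> b2.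
        (x \<otimes> u) \<otimes> ((y \<otimes> v) \<otimes> (z \<otimes> w)))"
      by (subst coassoc_sum) (intro clinear_intros refl)+
    also have "\<dots> = (\<Sum>x \<otimes> a2 \<leftarrow> \<Delta> a. \<Sum>y \<otimes> z \<leftarrow> \<Delta> a2. \<Sum>u \<otimes> b2 \<leftarrow> \<Delta> b. \<Sum>v \<otimes> w \<leftarrow> \<Delta> b2.
        (x \<otimes> u) \<otimes> ((y \<otimes> v) \<otimes> (z \<otimes> w)))"
      by (rule coassoc_sum) (intro clinear_intros)+
    also have "\<dots> = (\<Sum>x \<otimes> a2 \<leftarrow> \<Delta> a. \<Sum>u \<otimes> b2 \<leftarrow> \<Delta> b. \<Sum>y \<otimes> z \<leftarrow> \<Delta> a2. \<Sum>v \<otimes> w \<leftarrow> \<Delta> b2.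
        (x \<otimes> u) \<otimes> ((y \<otimes> v) \<otimes> (z \<otimes> w)))"
      by (subst tensor_sum_swap[where t = "\<Delta> b"]) (rule refl)
    also have "\<dots> = (\<Sum>x \<otimes> a2 \<leftarrow> \<Delta> a. \<Sum>u \<otimes> b2 \<leftarrow> \<Delta> b. (x \<otimes> u) \<otimes> tensor_comult \<Delta> (a2 \<otimes> b2))"
      unfolding tensor_comult_of clinear_tensor_sum[OF clinear_tensor_of(2)] ..
    also have "\<dots> = (\<Sum>p \<otimes> q \<leftarrow> tensor_comult \<Delta> (a \<otimes> b). p \<otimes> tensor_comult \<Delta> q)"
      by (rule tensor_comult_sum[symmetric]) (intro clinear_intros)+
    also have "\<dots> = ((id \<otimes>\<^sub>m tensor_comult \<Delta>) \<circ> tensor_comult \<Delta>) (a \<otimes> b)"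
      unfolding o_def
      by (subst clinear_eq_tensor_sum[of "\<lambda>t. (id \<otimes>\<^sub>m tensor_comult \<Delta>) t"])
        (intro clinear_intros clinear_tensor_comult clinear_id,
          simp add: tensor_map_of clinear_tensor_comult clinear_id)
    finally show "(tensor_assoc \<circ> (tensor_comult \<Delta> \<otimes>\<^sub>m id) \<circ> tensor_comult \<Delta>) (a \<otimes> b)
      = ((id \<otimes>\<^sub>m tensor_comult \<Delta>) \<circ> tensor_comult \<Delta>) (a \<otimes> b)" .
  qed
  show "scalar_left \<circ> (tensor_counit \<delta> \<otimes>\<^sub>m id) \<circ> tensor_comult \<Delta> = id"
  proof (rule clinear_tensor_ext)
    show "clinear (scalar_left \<circ> (tensor_counit \<delta> \<otimes>\<^sub>m id) \<circ> tensor_comult \<Delta>)"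
      by (intro clinear_compose clinear_scalar_left clinear_tensor_map clinear_tensor_comult
          clinear_tensor_counit clinear_id)
    show "clinear (id :: 'b \<otimes> 'b \<Rightarrow> _)" by (rule clinear_id)
    fix a b
    have "(scalar_left \<circ> (tensor_counit \<delta> \<otimes>\<^sub>m id) \<circ> tensor_comult \<Delta>) (a \<otimes> b)
        = (\<Sum>p \<otimes> q \<leftarrow> tensor_comult \<Delta> (a \<otimes> b). tensor_counit \<delta> p *\<^sub>C q)"
      unfolding o_def
      by (subst clinear_eq_tensor_sum[of "\<lambda>t. scalar_left ((tensor_counit \<delta> \<otimes>\<^sub>m id) t)"])
        (intro clinear_comp[OF clinear_scalar_left] clinear_intros clinear_tensor_counit clinear_id,
          simp add: tensor_map_of clinear_tensor_counit clinear_id scalar_left_of)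
    also have "\<dots> = (\<Sum>a1 \<otimes> a2 \<leftarrow> \<Delta> a. \<Sum>b1 \<otimes> b2 \<leftarrow> \<Delta> b. tensor_counit \<delta> (a1 \<otimes> b1) *\<^sub>C (a2 \<otimes> b2))"
      by (rule tensor_comult_sum) (intro clinear_intros)+
    also have "\<dots> = (\<Sum>a1 \<otimes> a2 \<leftarrow> \<Delta> a. \<delta> a1 *\<^sub>C (\<Sum>b1 \<otimes> b2 \<leftarrow> \<Delta> b. \<delta> b1 *\<^sub>C (a2 \<otimes> b2)))"
      by (simp add: tensor_counit_of scaleC_tensor_sum scaleC_scaleC)
    also have "\<dots> = a \<otimes> b"
      by (simp add: counit_left_sum clinear_tensor_of)
    finally show "(scalar_left \<circ> (tensor_counit \<delta> \<otimes>\<^sub>m id) \<circ> tensor_comult \<Delta>) (a \<otimes> b) = id (a \<otimes> b)"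
      by simp
  qed
  show "scalar_right \<circ> (id \<otimes>\<^sub>m tensor_counit \<delta>) \<circ> tensor_comult \<Delta> = id"
  proof (rule clinear_tensor_ext)
    show "clinear (scalar_right \<circ> (id \<otimes>\<^sub>m tensor_counit \<delta>) \<circ> tensor_comult \<Delta>)"
      by (intro clinear_compose clinear_scalar_right clinear_tensor_map clinear_tensor_comult
          clinear_tensor_counit clinear_id)
    show "clinear (id :: 'b \<otimes> 'b \<Rightarrow> _)" by (rule clinear_id)
    fix a b
    have "(scalar_right \<circ> (id \<otimes>\<^sub>m tensor_counit \<delta>) \<circ> tensor_comult \<Delta>) (a \<otimes> b)
        = (\<Sum>p \<otimes> q \<leftarrow> tensor_comult \<Delta> (a \<otimes> b). tensor_counit \<delta> q *\<^sub>C p)"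
      unfolding o_def
      by (subst clinear_eq_tensor_sum[of "\<lambda>t. scalar_right ((id \<otimes>\<^sub>m tensor_counit \<delta>) t)"])
        (intro clinear_comp[OF clinear_scalar_right] clinear_intros clinear_tensor_counit clinear_id,
          simp add: tensor_map_of clinear_tensor_counit clinear_id scalar_right_of)
    also have "\<dots> = (\<Sum>a1 \<otimes> a2 \<leftarrow> \<Delta> a. \<Sum>b1 \<otimes> b2 \<leftarrow> \<Delta> b. tensor_counit \<delta> (a2 \<otimes> b2) *\<^sub>C (a1 \<otimes> b1))"
      by (rule tensor_comult_sum) (intro clinear_intros)+
    also have "\<dots> = (\<Sum>a1 \<otimes> a2 \<leftarrow> \<Delta> a. \<delta> a2 *\<^sub>C (\<Sum>b1 \<otimes> b2 \<leftarrow> \<Delta> b. \<delta> b2 *\<^sub>C (a1 \<otimes> b1)))"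
      by (simp add: tensor_counit_of scaleC_tensor_sum scaleC_scaleC)
    also have "\<dots> = a \<otimes> b"
      by (simp add: counit_right_sum clinear_tensor_of)
    finally show "(scalar_right \<circ> (id \<otimes>\<^sub>m tensor_counit \<delta>) \<circ> tensor_comult \<Delta>) (a \<otimes> b) = id (a \<otimes> b)"
      by simp
  qed
qed

end

section \<open>Antipodes and comultiplication\<close>

context unital_algebra
begin

abbreviation mult (infixl \<open>\<cdot>\<close> 76)
  where "a \<cdot> b \<equiv> \<mu> (a \<otimes> b)"

lemmas clinear_mult [clinear_intros] = clinear_comp[OF mult_linear]

lemma mult_assoc_of: "(a \<cdot> b) \<cdot> c = a \<cdot> (b \<cdot> c)"
proof -
  have "(\<mu> \<circ> (\<mu> \<otimes>\<^sub>m id)) ((a \<otimes> b) \<otimes> c) = (\<mu> \<circ> (id \<otimes>\<^sub>m \<mu>) \<circ> tensor_assoc) ((a \<otimes> b) \<otimes> c)"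
    by (simp only: mult_assoc)
  then show ?thesis
    by (simp add: tensor_map_of mult_linear clinear_id tensor_assoc_of)
qed

lemma mult_scaleC: "\<mu> (c *\<^sub>C t) = c *\<^sub>C \<mu> t"
  using mult_linear by (simp add: clinear_iff)

end

context bialgebra
begin

lemma comult_mult_sum:
  assumes "\<And>y. clinear (\<lambda>x. \<beta> x y)" "\<And>x. clinear (\<beta> x)"
  shows "(\<Sum>p \<otimes> q \<leftarrow> \<Delta> (a \<cdot> b). \<beta> p q)
    = (\<Sum>a1 \<otimes> a2 \<leftarrow> \<Delta> a. \<Sum>b1 \<otimes> b2 \<leftarrow> \<Delta> b. \<beta> (a1 \<cdot> b1) (a2 \<cdot> b2))"
proof -
  have "\<Delta> (a \<cdot> b) = (\<mu> \<otimes>\<^sub>m \<mu>) (tensor_comult \<Delta> (a \<otimes> b))"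
    using comult_mult by (simp add: fun_eq_iff)
  then have "(\<Sum>p \<otimes> q \<leftarrow> \<Delta> (a \<cdot> b). \<beta> p q) = (\<Sum>p \<otimes> q \<leftarrow> tensor_comult \<Delta> (a \<otimes> b). \<beta> (\<mu> p) (\<mu> q))"
    using assms by (simp add: tensor_sum_tensor_map mult_linear)
  also have "\<dots> = (\<Sum>a1 \<otimes> a2 \<leftarrow> \<Delta> a. \<Sum>b1 \<otimes> b2 \<leftarrow> \<Delta> b. \<beta> (a1 \<cdot> b1) (a2 \<cdot> b2))"
    by (rule tensor_comult_sum) (rule clinear_comp[OF _ mult_linear] assms)+
  finally show ?thesis .
qed

lemma tensor_counit_mult: "tensor_counit \<delta> t = \<delta> (\<mu> t)"
  using counit_mult by (simp add: fun_eq_iff)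

lemma counit_mult_of: "\<delta> (a \<cdot> b) = \<delta> a * \<delta> b"
  using counit_mult by (simp add: fun_eq_iff tensor_counit_of)

end

context hopf_algebra
begin

lemma antipode_linear: "clinear S"
  using antipode by (simp add: is_antipode_def)

lemmas clinear_antipode [clinear_intros] = clinear_comp[OF antipode_linear]

lemma antipode_left: "(\<Sum>x \<otimes> y \<leftarrow> \<Delta> a. S x \<cdot> y) = \<delta> a *\<^sub>C unit"
proof -
  have "(\<mu> \<circ> (S \<otimes>\<^sub>m id) \<circ> \<Delta>) a = (\<Sum>x \<otimes> y \<leftarrow> \<Delta> a. S x \<cdot> y)"
    using convolution_sum[OF mult_linear antipode_linear clinear_id]
    by (simp add: convolution_def)
  then show ?thesis using antipode by (simp add: is_antipode_def fun_eq_iff)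
qed

lemma antipode_right: "(\<Sum>x \<otimes> y \<leftarrow> \<Delta> a. x \<cdot> S y) = \<delta> a *\<^sub>C unit"
proof -
  have "(\<mu> \<circ> (id \<otimes>\<^sub>m S) \<circ> \<Delta>) a = (\<Sum>x \<otimes> y \<leftarrow> \<Delta> a. x \<cdot> S y)"
    using convolution_sum[OF mult_linear clinear_id antipode_linear]
    by (simp add: convolution_def)
  then show ?thesis using antipode by (simp add: is_antipode_def fun_eq_iff)
qed

lemma antipode_left_sum:
  assumes "clinear g"
  shows "(\<Sum>x \<otimes> y \<leftarrow> \<Delta> a. g (S x \<cdot> y)) = \<delta> a *\<^sub>C g unit"
  using antipode_left[of a] assms clinear_tensor_sum[OF assms, of "\<Delta> a" "\<lambda>x y. S x \<cdot> y"]
  by (simp add: clinear_iff)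

lemma antipode_right_sum:
  assumes "clinear g"
  shows "(\<Sum>x \<otimes> y \<leftarrow> \<Delta> a. g (x \<cdot> S y)) = \<delta> a *\<^sub>C g unit"
  using antipode_right[of a] assms clinear_tensor_sum[OF assms, of "\<Delta> a" "\<lambda>x y. x \<cdot> S y"]
  by (simp add: clinear_iff)

text \<open>The antipode reverses the comultiplication, as \<open>\<Delta> \<circ> S\<close> and \<open>a \<mapsto> S a\<^sub>2 \<otimes> S a\<^sub>1\<close> are a left and a right
convolution inverse of \<open>\<Delta>\<close>. Explicitly, the expression
\<open>\<Delta>(S a\<^sub>1) \<cdot> (a\<^sub>2 \<otimes> a\<^sub>3) \<cdot> (S a\<^sub>5 \<otimes> S a\<^sub>4)\<close> in the tensor square is evaluated in two ways: cancelling the legs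
2 to 5 leaves \<open>\<Delta>(S a)\<close>, and cancelling the legs 1 to 3 leaves \<open>S a\<^sub>2 \<otimes> S a\<^sub>1\<close>.\<close>

lemma comult_antipode: "\<Delta> (S a) = (\<Sum>x \<otimes> y \<leftarrow> \<Delta> a. S y \<otimes> S x)"
proof -
  \<comment> \<open>The product \<open>\<Delta>(S a1) \<cdot> (p \<otimes> q)\<close> in the tensor square.\<close>
  define G where "G a1 p q = (\<Sum>u \<otimes> v \<leftarrow> \<Delta> (S a1). (u \<cdot> p) \<otimes> (v \<cdot> q))" for a1 p q
  have G: "clinear (\<lambda>a1. G a1 p q)" "clinear (\<lambda>p. G a1 p q)" "clinear (\<lambda>q. G a1 p q)" for a1 p q
    unfolding G_def by (intro clinear_intros)+
  note G' [clinear_intros] = G(1) G(2)[THEN clinear_comp] G(3)[THEN clinear_comp]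
  let ?E = "\<Sum>a1 \<otimes> r1 \<leftarrow> \<Delta> a. \<Sum>a2 \<otimes> r2 \<leftarrow> \<Delta> r1. \<Sum>a3 \<otimes> r3 \<leftarrow> \<Delta> r2. \<Sum>a4 \<otimes> a5 \<leftarrow> \<Delta> r3.
      G a1 (a2 \<cdot> S a5) (a3 \<cdot> S a4)"
  \<comment> \<open>Cancellation from the inside: \<open>a\<^sub>3\<close> with \<open>S a\<^sub>4\<close>, then \<open>a\<^sub>2\<close> with \<open>S a\<^sub>5\<close>.\<close>
  have right: "(\<Sum>a2 \<otimes> r2 \<leftarrow> \<Delta> b. \<Sum>a3 \<otimes> r3 \<leftarrow> \<Delta> r2. \<Sum>a4 \<otimes> a5 \<leftarrow> \<Delta> r3.
      G a1 (a2 \<cdot> S a5) (a3 \<cdot> S a4)) = \<delta> b *\<^sub>C \<Delta> (S a1)" for a1 b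
  proof -
    have "(\<Sum>a3 \<otimes> r3 \<leftarrow> \<Delta> r2. \<Sum>a4 \<otimes> a5 \<leftarrow> \<Delta> r3. G a1 (a2 \<cdot> S a5) (a3 \<cdot> S a4))
        = G a1 (a2 \<cdot> S r2) unit" for a2 r2
    proof -
      have "(\<Sum>a3 \<otimes> r3 \<leftarrow> \<Delta> r2. \<Sum>a4 \<otimes> a5 \<leftarrow> \<Delta> r3. G a1 (a2 \<cdot> S a5) (a3 \<cdot> S a4))
          = (\<Sum>w \<otimes> a5 \<leftarrow> \<Delta> r2. \<Sum>a3 \<otimes> a4 \<leftarrow> \<Delta> w. G a1 (a2 \<cdot> S a5) (a3 \<cdot> S a4))"
        by (rule coassoc_sum[symmetric]) (intro clinear_intros)+
      also have "\<dots> = (\<Sum>w \<otimes> a5 \<leftarrow> \<Delta> r2. \<delta> w *\<^sub>C G a1 (a2 \<cdot> S a5) unit)"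
        by (simp only: antipode_right_sum[OF G(3)])
      also have "\<dots> = G a1 (a2 \<cdot> S r2) unit"
        by (rule counit_left_sum) (intro clinear_intros)
      finally show ?thesis .
    qed
    moreover have "G a1 unit unit = \<Delta> (S a1)"
      by (simp add: G_def unit_right tensor_sum_pure)
    moreover have "(\<Sum>a2 \<otimes> r2 \<leftarrow> \<Delta> b. G a1 (a2 \<cdot> S r2) unit) = \<delta> b *\<^sub>C G a1 unit unit"
      by (rule antipode_right_sum) (rule G(2))
    ultimately show ?thesis by simp
  qed
  \<comment> \<open>Here \<open>\<Delta>(S a\<^sub>1) \<cdot> \<Delta> w\<close> is \<open>\<Delta>(S a\<^sub>1 \<cdot> w)\<close>, and the antipode cancels under \<open>\<Delta>\<close>.\<close>
  have left: "(\<Sum>a1 \<otimes> w \<leftarrow> \<Delta> z. \<Sum>a2 \<otimes> a3 \<leftarrow> \<Delta> w. G a1 (a2 \<cdot> p) (a3 \<cdot> q)) = \<delta> z *\<^sub>C (p \<otimes> q)" for z p q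
  proof -
    have "(\<Sum>a2 \<otimes> a3 \<leftarrow> \<Delta> w. G a1 (a2 \<cdot> p) (a3 \<cdot> q))
        = (\<Sum>u \<otimes> v \<leftarrow> \<Delta> (S a1 \<cdot> w). (u \<cdot> p) \<otimes> (v \<cdot> q))" for a1 w
    proof -
      have "(\<Sum>a2 \<otimes> a3 \<leftarrow> \<Delta> w. G a1 (a2 \<cdot> p) (a3 \<cdot> q))
          = (\<Sum>u \<otimes> v \<leftarrow> \<Delta> (S a1). \<Sum>a2 \<otimes> a3 \<leftarrow> \<Delta> w. (u \<cdot> a2 \<cdot> p) \<otimes> (v \<cdot> a3 \<cdot> q))"
        unfolding G_def by (subst tensor_sum_swap) (simp only: mult_assoc_of)
      also have "\<dots> = (\<Sum>u \<otimes> v \<leftarrow> \<Delta> (S a1 \<cdot> w). (u \<cdot> p) \<otimes> (v \<cdot> q))"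
        by (rule comult_mult_sum[symmetric]) (intro clinear_intros)+
      finally show ?thesis .
    qed
    moreover have "clinear (\<lambda>t. \<Sum>u \<otimes> v \<leftarrow> \<Delta> t. (u \<cdot> p) \<otimes> (v \<cdot> q))"
      by (intro clinear_intros)
    from antipode_left_sum[OF this, of z]
    have "(\<Sum>a1 \<otimes> w \<leftarrow> \<Delta> z. \<Sum>u \<otimes> v \<leftarrow> \<Delta> (S a1 \<cdot> w). (u \<cdot> p) \<otimes> (v \<cdot> q)) = \<delta> z *\<^sub>C (p \<otimes> q)"
      by (simp add: comult_unit tensor_sum_tensor_of clinear_intros unit_left)
    ultimately show ?thesis by simp
  qed
  have "?E = (\<Sum>a1 \<otimes> r1 \<leftarrow> \<Delta> a. \<delta> r1 *\<^sub>C \<Delta> (S a1))"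
    by (simp only: right)
  also have "\<dots> = \<Delta> (S a)"
    by (rule counit_right_sum) (intro clinear_intros)
  finally have 1: "?E = \<Delta> (S a)" .
  have "?E = (\<Sum>a1 \<otimes> r1 \<leftarrow> \<Delta> a. \<Sum>w \<otimes> r3 \<leftarrow> \<Delta> r1. \<Sum>a2 \<otimes> a3 \<leftarrow> \<Delta> w. \<Sum>a4 \<otimes> a5 \<leftarrow> \<Delta> r3.
      G a1 (a2 \<cdot> S a5) (a3 \<cdot> S a4))"
    by (subst coassoc_sum) (intro clinear_intros refl)+
  also have "\<dots> = (\<Sum>z \<otimes> r3 \<leftarrow> \<Delta> a. \<Sum>a1 \<otimes> w \<leftarrow> \<Delta> z. \<Sum>a2 \<otimes> a3 \<leftarrow> \<Delta> w. \<Sum>a4 \<otimes> a5 \<leftarrow> \<Delta> r3.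
      G a1 (a2 \<cdot> S a5) (a3 \<cdot> S a4))"
    by (rule coassoc_sum[symmetric]) (intro clinear_intros)+
  also have "\<dots> = (\<Sum>z \<otimes> r3 \<leftarrow> \<Delta> a. \<Sum>a4 \<otimes> a5 \<leftarrow> \<Delta> r3. \<Sum>a1 \<otimes> w \<leftarrow> \<Delta> z. \<Sum>a2 \<otimes> a3 \<leftarrow> \<Delta> w.
      G a1 (a2 \<cdot> S a5) (a3 \<cdot> S a4))"
  proof -
    have "(\<Sum>a1 \<otimes> w \<leftarrow> \<Delta> z. \<Sum>a2 \<otimes> a3 \<leftarrow> \<Delta> w. \<Sum>a4 \<otimes> a5 \<leftarrow> \<Delta> r3. G a1 (a2 \<cdot> S a5) (a3 \<cdot> S a4))
        = (\<Sum>a1 \<otimes> w \<leftarrow> \<Delta> z. \<Sum>a4 \<otimes> a5 \<leftarrow> \<Delta> r3. \<Sum>a2 \<otimes> a3 \<leftarrow> \<Delta> w. G a1 (a2 \<cdot> S a5) (a3 \<cdot> S a4))" for z r3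
      by (subst tensor_sum_swap) (rule refl)
    also have "\<dots> z r3 = (\<Sum>a4 \<otimes> a5 \<leftarrow> \<Delta> r3. \<Sum>a1 \<otimes> w \<leftarrow> \<Delta> z. \<Sum>a2 \<otimes> a3 \<leftarrow> \<Delta> w. G a1 (a2 \<cdot> S a5) (a3 \<cdot> S a4))" for z r3
      by (rule tensor_sum_swap)
    finally show ?thesis by (simp only:)
  qed
  also have "\<dots> = (\<Sum>z \<otimes> r3 \<leftarrow> \<Delta> a. \<delta> z *\<^sub>C (\<Sum>a4 \<otimes> a5 \<leftarrow> \<Delta> r3. S a5 \<otimes> S a4))"
    by (simp only: left scaleC_tensor_sum)
  also have "\<dots> = (\<Sum>x \<otimes> y \<leftarrow> \<Delta> a. S y \<otimes> S x)"
    by (rule counit_left_sum) (intro clinear_intros)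
  finally show ?thesis using 1 by simp
qed

lemma comult_antipode_sum:
  assumes "\<And>y. clinear (\<lambda>x. \<beta> x y)" "\<And>x. clinear (\<beta> x)"
  shows "(\<Sum>p \<otimes> q \<leftarrow> \<Delta> (S a). \<beta> p q) = (\<Sum>x \<otimes> y \<leftarrow> \<Delta> a. \<beta> (S y) (S x))"
  unfolding comult_antipode using assms by (simp add: tensor_sum_comp tensor_sum_tensor_of)

text \<open>The comultiplication of \<open>a\<^sub>1 \<otimes> S a\<^sub>2\<close> is \<open>(a\<^sub>1 \<otimes> S a\<^sub>4) \<otimes> (a\<^sub>2 \<otimes> S a\<^sub>3)\<close>: since \<open>S\<close> reverses the order, an
element of the same shape is nested inside.\<close>

lemma comult_id_antipode:
  assumes \<beta>: "\<And>y. clinear (\<lambda>x. \<beta> x y)" "\<And>x. clinear (\<beta> x)"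
  shows "(\<Sum>p \<otimes> q \<leftarrow> tensor_comult \<Delta> (\<Sum>x \<otimes> y \<leftarrow> \<Delta> a. x \<otimes> S y). \<beta> p q)
    = (\<Sum>a1 \<otimes> r \<leftarrow> \<Delta> a. \<Sum>w \<otimes> a3 \<leftarrow> \<Delta> r. \<beta> (a1 \<otimes> S a3) (\<Sum>x \<otimes> y \<leftarrow> \<Delta> w. x \<otimes> S y))"
proof -
  note [clinear_intros] = \<beta>(1)[THEN clinear_comp] \<beta>(2)[THEN clinear_comp]
  have "clinear (\<lambda>t. \<Sum>p \<otimes> q \<leftarrow> tensor_comult \<Delta> t. \<beta> p q)"
    by (intro clinear_intros \<beta> clinear_tensor_comult)
  from clinear_tensor_sum[OF this, of "\<Delta> a" "\<lambda>x y. x \<otimes> S y"]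
  have "(\<Sum>p \<otimes> q \<leftarrow> tensor_comult \<Delta> (\<Sum>x \<otimes> y \<leftarrow> \<Delta> a. x \<otimes> S y). \<beta> p q)
      = (\<Sum>x \<otimes> y \<leftarrow> \<Delta> a. \<Sum>a1 \<otimes> a2 \<leftarrow> \<Delta> x. \<Sum>b1 \<otimes> b2 \<leftarrow> \<Delta> (S y). \<beta> (a1 \<otimes> b1) (a2 \<otimes> b2))"
    by (simp only: tensor_comult_sum[OF \<beta>])
  also have "\<dots> = (\<Sum>x \<otimes> y \<leftarrow> \<Delta> a. \<Sum>a1 \<otimes> a2 \<leftarrow> \<Delta> x. \<Sum>y1 \<otimes> y2 \<leftarrow> \<Delta> y. \<beta> (a1 \<otimes> S y2) (a2 \<otimes> S y1))"
    by (subst comult_antipode_sum) (intro clinear_intros refl)+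
  also have "\<dots> = (\<Sum>a1 \<otimes> r \<leftarrow> \<Delta> a. \<Sum>a2 \<otimes> y \<leftarrow> \<Delta> r. \<Sum>y1 \<otimes> y2 \<leftarrow> \<Delta> y. \<beta> (a1 \<otimes> S y2) (a2 \<otimes> S y1))"
    by (rule coassoc_sum) (intro clinear_intros)+
  also have "\<dots> = (\<Sum>a1 \<otimes> r \<leftarrow> \<Delta> a. \<Sum>w \<otimes> y2 \<leftarrow> \<Delta> r. \<Sum>a2 \<otimes> y1 \<leftarrow> \<Delta> w. \<beta> (a1 \<otimes> S y2) (a2 \<otimes> S y1))"
    by (subst coassoc_sum) (intro clinear_intros refl)+
  finally show ?thesis
    by (simp only: clinear_tensor_sum[OF \<beta>(2)])
qed

text \<open>For \<open>S a\<^sub>1 \<otimes> a\<^sub>2\<close> the comultiplication is \<open>(S a\<^sub>2 \<otimes> a\<^sub>3) \<otimes> (S a\<^sub>1 \<otimes> a\<^sub>4)\<close>, so the nested element now stands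
in the first leg of the tensor square.\<close>

lemma comult_antipode_id:
  assumes \<beta>: "\<And>y. clinear (\<lambda>x. \<beta> x y)" "\<And>x. clinear (\<beta> x)"
  shows "(\<Sum>p \<otimes> q \<leftarrow> tensor_comult \<Delta> (\<Sum>x \<otimes> y \<leftarrow> \<Delta> a. S x \<otimes> y). \<beta> p q)
    = (\<Sum>a1 \<otimes> r \<leftarrow> \<Delta> a. \<Sum>w \<otimes> a3 \<leftarrow> \<Delta> r. \<beta> (\<Sum>x \<otimes> y \<leftarrow> \<Delta> w. S x \<otimes> y) (S a1 \<otimes> a3))"
proof -
  note [clinear_intros] = \<beta>(1)[THEN clinear_comp] \<beta>(2)[THEN clinear_comp]
  have "clinear (\<lambda>t. \<Sum>p \<otimes> q \<leftarrow> tensor_comult \<Delta> t. \<beta> p q)"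
    by (intro clinear_intros \<beta> clinear_tensor_comult)
  from clinear_tensor_sum[OF this, of "\<Delta> a" "\<lambda>x y. S x \<otimes> y"]
  have "(\<Sum>p \<otimes> q \<leftarrow> tensor_comult \<Delta> (\<Sum>x \<otimes> y \<leftarrow> \<Delta> a. S x \<otimes> y). \<beta> p q)
      = (\<Sum>x \<otimes> y \<leftarrow> \<Delta> a. \<Sum>a1 \<otimes> a2 \<leftarrow> \<Delta> (S x). \<Sum>b1 \<otimes> b2 \<leftarrow> \<Delta> y. \<beta> (a1 \<otimes> b1) (a2 \<otimes> b2))"
    by (simp only: tensor_comult_sum[OF \<beta>])
  also have "\<dots> = (\<Sum>x \<otimes> y \<leftarrow> \<Delta> a. \<Sum>a1 \<otimes> a2 \<leftarrow> \<Delta> x. \<Sum>b1 \<otimes> b2 \<leftarrow> \<Delta> y. \<beta> (S a2 \<otimes> b1) (S a1 \<otimes> b2))"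
    by (subst comult_antipode_sum) (intro clinear_intros refl)+
  also have "\<dots> = (\<Sum>a1 \<otimes> r \<leftarrow> \<Delta> a. \<Sum>a2 \<otimes> y \<leftarrow> \<Delta> r. \<Sum>b1 \<otimes> b2 \<leftarrow> \<Delta> y. \<beta> (S a2 \<otimes> b1) (S a1 \<otimes> b2))"
    by (rule coassoc_sum) (intro clinear_intros)+
  also have "\<dots> = (\<Sum>a1 \<otimes> r \<leftarrow> \<Delta> a. \<Sum>w \<otimes> b2 \<leftarrow> \<Delta> r. \<Sum>a2 \<otimes> b1 \<leftarrow> \<Delta> w. \<beta> (S a2 \<otimes> b1) (S a1 \<otimes> b2))"
    by (subst coassoc_sum) (intro clinear_intros refl)+
  finally show ?thesis
    by (simp only: clinear_tensor_sum[OF \<beta>(1)])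
qed

end

section \<open>Functionals that commute with the multiplication\<close>

text \<open>The functional \<open>K\<close> will be \<open>t L\<close> for a generator \<open>L\<close> and a real number \<open>t\<close>; the assumption
\<open>K_commutes\<close> is \<open>\<mu> \<star> K = K \<star> \<mu>\<close>.\<close>

locale commuting_functional = hopf_algebra \<mu> unit \<Delta> \<delta> S
  for \<mu> :: "'b::complex_vector \<otimes> 'b \<Rightarrow> 'b" and unit :: 'b
    and \<Delta> :: "'b \<Rightarrow> 'b \<otimes> 'b" and \<delta> :: "'b \<Rightarrow> complex" and S :: "'b \<Rightarrow> 'b" +
  fixes K :: "'b \<otimes> 'b \<Rightarrow> complex"
  assumes K_linear: "clinear K"
    and K_commutes: "(\<Sum>p \<otimes> q \<leftarrow> tensor_comult \<Delta> x. K q *\<^sub>C \<mu> p)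
      = (\<Sum>p \<otimes> q \<leftarrow> tensor_comult \<Delta> x. K p *\<^sub>C \<mu> q)"
begin

lemmas clinear_K [clinear_intros] = clinear_comp[OF K_linear]

definition \<kappa> :: "'b \<Rightarrow> complex"
  where "\<kappa> a = K (\<Sum>x \<otimes> y \<leftarrow> \<Delta> a. x \<otimes> S y)"

lemma \<kappa>_linear: "clinear \<kappa>"
  unfolding \<kappa>_def[abs_def] by (intro clinear_intros)

lemmas clinear_\<kappa> [clinear_intros] = clinear_comp[OF \<kappa>_linear]

lemma mult_id_antipode: "\<mu> (\<Sum>x \<otimes> y \<leftarrow> \<Delta> a. x \<otimes> S y) = \<delta> a *\<^sub>C unit"
  by (simp add: clinear_tensor_sum[OF mult_linear] antipode_right)

lemma mult_antipode_id: "\<mu> (\<Sum>x \<otimes> y \<leftarrow> \<Delta> a. S x \<otimes> y) = \<delta> a *\<^sub>C unit"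
  by (simp add: clinear_tensor_sum[OF mult_linear] antipode_left)

text \<open>This is \<open>\<mu> \<star> K = K \<star> \<mu>\<close> evaluated at \<open>a\<^sub>1 \<otimes> S a\<^sub>2\<close>. On the left the nested copy is absorbed by \<open>K\<close> into
\<open>\<kappa>(a\<^sub>2)\<close>; on the right it is multiplied out to \<open>\<delta>(a\<^sub>2) 1\<close>.\<close>

lemma \<kappa>_conjugation:
  "(\<Sum>a1 \<otimes> r \<leftarrow> \<Delta> a. \<Sum>w \<otimes> a3 \<leftarrow> \<Delta> r. \<kappa> w *\<^sub>C (a1 \<cdot> S a3)) = \<kappa> a *\<^sub>C unit"
proof -
  let ?f = "\<lambda>a. \<Sum>x \<otimes> y \<leftarrow> \<Delta> a. x \<otimes> S y"
  have "(\<Sum>a1 \<otimes> r \<leftarrow> \<Delta> a. \<Sum>w \<otimes> a3 \<leftarrow> \<Delta> r. \<kappa> w *\<^sub>C (a1 \<cdot> S a3))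
      = (\<Sum>p \<otimes> q \<leftarrow> tensor_comult \<Delta> (?f a). K q *\<^sub>C \<mu> p)"
    unfolding \<kappa>_def by (rule comult_id_antipode[symmetric]) (intro clinear_intros mult_linear K_linear)+
  also have "\<dots> = (\<Sum>p \<otimes> q \<leftarrow> tensor_comult \<Delta> (?f a). K p *\<^sub>C \<mu> q)"
    by (rule K_commutes)
  also have "\<dots> = (\<Sum>a1 \<otimes> r \<leftarrow> \<Delta> a. \<Sum>w \<otimes> a3 \<leftarrow> \<Delta> r. K (a1 \<otimes> S a3) *\<^sub>C \<mu> (?f w))"
    by (rule comult_id_antipode) (intro clinear_intros mult_linear K_linear)+
  also have "\<dots> = (\<Sum>a1 \<otimes> r \<leftarrow> \<Delta> a. \<Sum>w \<otimes> a3 \<leftarrow> \<Delta> r. \<delta> w *\<^sub>C (K (a1 \<otimes> S a3) *\<^sub>C unit))"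
    by (simp only: mult_id_antipode scaleC_scaleC mult.commute)
  also have "\<dots> = (\<Sum>a1 \<otimes> r \<leftarrow> \<Delta> a. K (a1 \<otimes> S r) *\<^sub>C unit)"
    by (subst counit_left_sum) (intro clinear_intros refl)+
  also have "\<dots> = \<kappa> a *\<^sub>C unit"
    by (simp only: \<kappa>_def clinear_tensor_sum[OF K_linear] tensor_sum_scaleC)
  finally show ?thesis .
qed

text \<open>Multiplying \<open>a\<^sub>1 \<kappa>(a\<^sub>2) S a\<^sub>3 = \<kappa>(a) 1\<close> by one more leg from the right cancels the antipode.\<close>

lemma \<kappa>_central: "conv_central \<kappa>"
  unfolding conv_central_def
proof
  fix a
  have "(\<Sum>x \<otimes> y \<leftarrow> \<Delta> a. \<kappa> x *\<^sub>C y) = (\<Sum>x \<otimes> y \<leftarrow> \<Delta> a. (\<kappa> x *\<^sub>C unit) \<cdot> y)"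
    by (simp only: tensor_scale_left mult_scaleC unit_left)
  also have "\<dots> = (\<Sum>x \<otimes> y \<leftarrow> \<Delta> a. \<Sum>a1 \<otimes> r \<leftarrow> \<Delta> x. \<Sum>w \<otimes> a3 \<leftarrow> \<Delta> r. \<kappa> w *\<^sub>C (a1 \<cdot> (S a3 \<cdot> y)))"
    by (simp only: \<kappa>_conjugation[symmetric] clinear_tensor_sum[OF clinear_tensor_of(1)]
        clinear_tensor_sum[OF mult_linear] tensor_scale_left mult_scaleC mult_assoc_of)
  also have "\<dots> = (\<Sum>a1 \<otimes> v \<leftarrow> \<Delta> a. \<Sum>r \<otimes> y \<leftarrow> \<Delta> v. \<Sum>w \<otimes> a3 \<leftarrow> \<Delta> r. \<kappa> w *\<^sub>C (a1 \<cdot> (S a3 \<cdot> y)))"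
    by (rule coassoc_sum) (intro clinear_intros)+
  also have "\<dots> = (\<Sum>a1 \<otimes> v \<leftarrow> \<Delta> a. \<Sum>w \<otimes> r \<leftarrow> \<Delta> v. \<Sum>a3 \<otimes> y \<leftarrow> \<Delta> r. \<kappa> w *\<^sub>C (a1 \<cdot> (S a3 \<cdot> y)))"
    by (subst coassoc_sum) (intro clinear_intros refl)+
  also have "\<dots> = (\<Sum>a1 \<otimes> v \<leftarrow> \<Delta> a. \<Sum>w \<otimes> r \<leftarrow> \<Delta> v. \<delta> r *\<^sub>C \<kappa> w *\<^sub>C (a1 \<cdot> unit))"
    by (subst antipode_left_sum) (intro clinear_intros refl)+
  also have "\<dots> = (\<Sum>x \<otimes> y \<leftarrow> \<Delta> a. \<kappa> y *\<^sub>C x)"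
    by (subst counit_right_sum) (intro clinear_intros, simp only: unit_right)
  finally show "(\<Sum>x \<otimes> y \<leftarrow> \<Delta> a. \<kappa> y *\<^sub>C x) = (\<Sum>x \<otimes> y \<leftarrow> \<Delta> a. \<kappa> x *\<^sub>C y)" ..
qed

lemma counit_scaleC_unit: "\<delta> (c *\<^sub>C unit) = c"
  using counit_linear by (simp add: clinear_iff counit_unit scaleC_complex_def)

text \<open>The nested copy of \<open>a\<^sub>1 \<otimes> S a\<^sub>2\<close> is evaluated by the induction hypothesis to the central
functional \<open>\<kappa>\<^bsup>\<star>n\<^esup>\<close> on the middle leg. Once that is moved out, \<open>K\<close> acts on neighbouring legs and
contributes the last factor \<open>\<kappa>\<close>.\<close>

lemma conv_power_id_antipode:
  "conv_power (tensor_comult \<Delta>) (tensor_counit \<delta>) K n (\<Sum>x \<otimes> y \<leftarrow> \<Delta> a. x \<otimes> S y)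
    = conv_power \<Delta> \<delta> \<kappa> n a"
proof (induction n arbitrary: a)
  case 0
  show ?case
    by (simp add: tensor_counit_mult mult_id_antipode counit_scaleC_unit)
next
  case (Suc n)
  interpret T: coalgebra "tensor_comult \<Delta>" "tensor_counit \<delta>"
    by (rule tensor_coalgebra)
  let ?P = "conv_power (tensor_comult \<Delta>) (tensor_counit \<delta>) K" and ?p = "conv_power \<Delta> \<delta> \<kappa>"
  note P = T.clinear_conv_power[OF K_linear]
  note p = clinear_conv_power[OF \<kappa>_linear, of n] conv_central_power[OF \<kappa>_linear \<kappa>_central, of n]
  have "?P (Suc n) (\<Sum>x \<otimes> y \<leftarrow> \<Delta> a. x \<otimes> S y)
      = (\<Sum>a1 \<otimes> r \<leftarrow> \<Delta> a. \<Sum>w \<otimes> a3 \<leftarrow> \<Delta> r. K (a1 \<otimes> S a3) * ?P n (\<Sum>x \<otimes> y \<leftarrow> \<Delta> w. x \<otimes> S y))"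
    unfolding T.conv_power_Suc_sum[OF K_linear]
    by (rule comult_id_antipode) (intro clinear_intros K_linear P)+
  also have "\<dots> = (\<Sum>a1 \<otimes> r \<leftarrow> \<Delta> a. \<Sum>w \<otimes> a3 \<leftarrow> \<Delta> r. ?p n w *\<^sub>C K (a1 \<otimes> S a3))"
    by (simp only: Suc.IH scaleC_complex_def mult.commute)
  also have "\<dots> = (\<Sum>w \<otimes> r \<leftarrow> \<Delta> a. ?p n w *\<^sub>C (\<Sum>x \<otimes> y \<leftarrow> \<Delta> r. K (x \<otimes> S y)))"
    by (rule conv_central_middle) (intro clinear_intros p)+
  also have "\<dots> = (\<Sum>w \<otimes> r \<leftarrow> \<Delta> a. ?p n w *\<^sub>C \<kappa> r)"
    by (simp only: \<kappa>_def clinear_tensor_sum[OF K_linear])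
  also have "\<dots> = (\<Sum>w \<otimes> r \<leftarrow> \<Delta> a. ?p n r *\<^sub>C \<kappa> w)"
    by (rule conv_centralD[symmetric]) (rule p \<kappa>_linear)+
  also have "\<dots> = ?p (Suc n) a"
    unfolding conv_power_Suc_sum[OF \<kappa>_linear] by (simp only: scaleC_complex_def mult.commute)
  finally show ?case .
qed

text \<open>Here the nested copy is evaluated by \<open>K\<close> itself, which gives \<open>\<kappa>\<close> on the middle leg, and the
induction hypothesis applies after it has been moved out.\<close>

lemma conv_power_antipode_id:
  assumes K: "\<And>a. K (\<Sum>x \<otimes> y \<leftarrow> \<Delta> a. S x \<otimes> y) = \<kappa> a"
  shows "conv_power (tensor_comult \<Delta>) (tensor_counit \<delta>) K n (\<Sum>x \<otimes> y \<leftarrow> \<Delta> a. S x \<otimes> y)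
    = conv_power \<Delta> \<delta> \<kappa> n a"
proof (induction n arbitrary: a)
  case 0
  show ?case
    by (simp add: tensor_counit_mult mult_antipode_id counit_scaleC_unit)
next
  case (Suc n)
  interpret T: coalgebra "tensor_comult \<Delta>" "tensor_counit \<delta>"
    by (rule tensor_coalgebra)
  let ?P = "conv_power (tensor_comult \<Delta>) (tensor_counit \<delta>) K" and ?p = "conv_power \<Delta> \<delta> \<kappa>"
  note P = T.clinear_conv_power[OF K_linear, of n]
  have "?P (Suc n) (\<Sum>x \<otimes> y \<leftarrow> \<Delta> a. S x \<otimes> y)
      = (\<Sum>a1 \<otimes> r \<leftarrow> \<Delta> a. \<Sum>w \<otimes> a3 \<leftarrow> \<Delta> r. K (\<Sum>x \<otimes> y \<leftarrow> \<Delta> w. S x \<otimes> y) * ?P n (S a1 \<otimes> a3))"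
    unfolding T.conv_power_Suc_sum[OF K_linear]
    by (rule comult_antipode_id) (intro clinear_intros K_linear P)+
  also have "\<dots> = (\<Sum>a1 \<otimes> r \<leftarrow> \<Delta> a. \<Sum>w \<otimes> a3 \<leftarrow> \<Delta> r. \<kappa> w *\<^sub>C ?P n (S a1 \<otimes> a3))"
    by (simp only: K scaleC_complex_def)
  also have "\<dots> = (\<Sum>w \<otimes> r \<leftarrow> \<Delta> a. \<kappa> w *\<^sub>C (\<Sum>x \<otimes> y \<leftarrow> \<Delta> r. ?P n (S x \<otimes> y)))"
    by (rule conv_central_middle) (rule \<kappa>_linear \<kappa>_central | intro clinear_intros clinear_comp[OF P])+
  also have "\<dots> = (\<Sum>w \<otimes> r \<leftarrow> \<Delta> a. \<kappa> w * ?p n r)"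
    by (simp only: Suc.IH scaleC_complex_def flip: clinear_tensor_sum[OF P])
  also have "\<dots> = ?p (Suc n) a"
    by (simp only: conv_power_Suc_sum[OF \<kappa>_linear])
  finally show ?case .
qed

lemma conv_exp_id_antipode:
  "conv_exp (tensor_comult \<Delta>) (tensor_counit \<delta>) K (\<Sum>x \<otimes> y \<leftarrow> \<Delta> a. x \<otimes> S y) = conv_exp \<Delta> \<delta> \<kappa> a"
  by (simp add: conv_exp_def conv_power_id_antipode)

lemma conv_exp_antipode_id:
  assumes "\<And>a. K (\<Sum>x \<otimes> y \<leftarrow> \<Delta> a. S x \<otimes> y) = \<kappa> a"
  shows "conv_exp (tensor_comult \<Delta>) (tensor_counit \<delta>) K (\<Sum>x \<otimes> y \<leftarrow> \<Delta> a. S x \<otimes> y) = conv_exp \<Delta> \<delta> \<kappa> a"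
  by (simp add: conv_exp_def conv_power_antipode_id[OF assms])

text \<open>The deformed multiplication \<open>\<mu> \<star> e\<^sub>\<star>\<^bsup>K\<^esup>\<close>.\<close>

abbreviation exp_mult :: "'b \<otimes> 'b \<Rightarrow> 'b"
  where "exp_mult \<equiv> convolution (tensor_comult \<Delta>) scalar_right \<mu>
    (conv_exp (tensor_comult \<Delta>) (tensor_counit \<delta>) K)"

lemma clinear_exp_K: "clinear (conv_exp (tensor_comult \<Delta>) (tensor_counit \<delta>) K)"
  by (rule coalgebra.clinear_conv_exp[OF tensor_coalgebra K_linear])

lemma exp_mult_sum:
  "exp_mult t = (\<Sum>p \<otimes> q \<leftarrow> tensor_comult \<Delta> t. conv_exp (tensor_comult \<Delta>) (tensor_counit \<delta>) K q *\<^sub>C \<mu> p)"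
  using coalgebra.convolution_sum[OF tensor_coalgebra clinear_scalar_right mult_linear clinear_exp_K]
  by (simp add: scalar_right_of)

lemma exp_mult_linear: "clinear exp_mult"
  unfolding convolution_def
  by (intro clinear_compose clinear_tensor_comult clinear_tensor_map mult_linear clinear_exp_K
      clinear_scalar_right)

lemma exp_mult_id_antipode:
  "exp_mult (\<Sum>x \<otimes> y \<leftarrow> \<Delta> a. x \<otimes> S y) = conv_exp \<Delta> \<delta> \<kappa> a *\<^sub>C unit"
proof -
  let ?e = "conv_exp \<Delta> \<delta> \<kappa>"
  note e = clinear_conv_exp[OF \<kappa>_linear] conv_central_exp[OF \<kappa>_linear \<kappa>_central]
  have "exp_mult (\<Sum>x \<otimes> y \<leftarrow> \<Delta> a. x \<otimes> S y)
      = (\<Sum>a1 \<otimes> r \<leftarrow> \<Delta> a. \<Sum>w \<otimes> a3 \<leftarrow> \<Delta> r.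
          conv_exp (tensor_comult \<Delta>) (tensor_counit \<delta>) K (\<Sum>x \<otimes> y \<leftarrow> \<Delta> w. x \<otimes> S y) *\<^sub>C (a1 \<cdot> S a3))"
    unfolding exp_mult_sum by (rule comult_id_antipode) (intro clinear_intros mult_linear clinear_exp_K)+
  also have "\<dots> = (\<Sum>a1 \<otimes> r \<leftarrow> \<Delta> a. \<Sum>w \<otimes> a3 \<leftarrow> \<Delta> r. ?e w *\<^sub>C (a1 \<cdot> S a3))"
    by (simp only: conv_exp_id_antipode)
  also have "\<dots> = (\<Sum>w \<otimes> r \<leftarrow> \<Delta> a. ?e w *\<^sub>C (\<Sum>x \<otimes> y \<leftarrow> \<Delta> r. x \<cdot> S y))"
    by (rule conv_central_middle) (rule e | intro clinear_intros)+
  also have "\<dots> = (\<Sum>w \<otimes> r \<leftarrow> \<Delta> a. \<delta> r *\<^sub>C (?e w *\<^sub>C unit))"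
    by (simp only: antipode_right scaleC_scaleC mult.commute)
  also have "\<dots> = ?e a *\<^sub>C unit"
    by (rule counit_right_sum) (intro clinear_intros e)
  finally show ?thesis .
qed

lemma exp_mult_antipode_id:
  assumes "\<And>a. K (\<Sum>x \<otimes> y \<leftarrow> \<Delta> a. S x \<otimes> y) = \<kappa> a"
  shows "exp_mult (\<Sum>x \<otimes> y \<leftarrow> \<Delta> a. S x \<otimes> y) = conv_exp \<Delta> \<delta> \<kappa> a *\<^sub>C unit"
proof -
  let ?E = "conv_exp (tensor_comult \<Delta>) (tensor_counit \<delta>) K"
  note E = clinear_comp[OF clinear_exp_K]
  have "exp_mult (\<Sum>x \<otimes> y \<leftarrow> \<Delta> a. S x \<otimes> y)
      = (\<Sum>a1 \<otimes> r \<leftarrow> \<Delta> a. \<Sum>w \<otimes> a3 \<leftarrow> \<Delta> r. ?E (S a1 \<otimes> a3) *\<^sub>C \<mu> (\<Sum>x \<otimes> y \<leftarrow> \<Delta> w. S x \<otimes> y))"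
    unfolding exp_mult_sum by (rule comult_antipode_id) (intro clinear_intros mult_linear clinear_exp_K)+
  also have "\<dots> = (\<Sum>a1 \<otimes> r \<leftarrow> \<Delta> a. \<Sum>w \<otimes> a3 \<leftarrow> \<Delta> r. \<delta> w *\<^sub>C (?E (S a1 \<otimes> a3) *\<^sub>C unit))"
    by (simp only: mult_antipode_id scaleC_scaleC mult.commute)
  also have "\<dots> = (\<Sum>a1 \<otimes> r \<leftarrow> \<Delta> a. ?E (S a1 \<otimes> r) *\<^sub>C unit)"
    by (subst counit_left_sum) (intro clinear_intros E refl)+
  also have "\<dots> = ?E (\<Sum>x \<otimes> y \<leftarrow> \<Delta> a. S x \<otimes> y) *\<^sub>C unit"
    by (simp only: clinear_tensor_sum[OF clinear_exp_K] tensor_sum_scaleC)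
  finally show ?thesis by (simp only: conv_exp_antipode_id[OF assms])
qed

text \<open>Write \<open>\<mu>\<^sub>K\<close> for \<^term>\<open>exp_mult\<close> and \<open>T = S \<star> e\<^sub>\<star>\<^bsup>- \<kappa>\<^esup>\<close>. In \<open>\<mu>\<^sub>K(a\<^sub>1 \<otimes> T a\<^sub>2)\<close> the factor \<open>e\<^sub>\<star>\<^bsup>- \<kappa>\<^esup>\<close> already sits on the
last leg and meets \<open>e\<^sub>\<star>\<^bsup>\<kappa>\<^esup>\<close> from \<open>\<mu>\<^sub>K(a\<^sub>1 \<otimes> S a\<^sub>2)\<close>. In \<open>\<mu>\<^sub>K(T a\<^sub>1 \<otimes> a\<^sub>2)\<close> it sits on the middle leg
and has to be moved out first; the hypothesis ensures that it meets the same
exponential there.\<close>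

theorem is_antipode_exp:
  assumes K: "\<And>a. K (\<Sum>x \<otimes> y \<leftarrow> \<Delta> a. S x \<otimes> y) = \<kappa> a"
  shows "is_antipode exp_mult unit \<Delta> \<delta>
    (convolution \<Delta> scalar_right S (conv_exp \<Delta> \<delta> (\<lambda>a. - \<kappa> a)))"
proof -
  let ?e = "conv_exp \<Delta> \<delta> \<kappa>" and ?e' = "conv_exp \<Delta> \<delta> (\<lambda>a. - \<kappa> a)"
  define T where "T = convolution \<Delta> scalar_right S ?e'"
  have neg: "clinear (\<lambda>a. - \<kappa> a)"
    using \<kappa>_linear by (simp add: clinear_iff)
  note e = clinear_conv_exp[OF \<kappa>_linear] conv_central_exp[OF \<kappa>_linear \<kappa>_central]
  note e' = clinear_conv_exp[OF neg] conv_central_exp[OF neg conv_central_uminus[OF \<kappa>_central]]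
  note M = clinear_comp[OF exp_mult_linear]
  have T_sum: "T a = (\<Sum>x \<otimes> y \<leftarrow> \<Delta> a. ?e' y *\<^sub>C S x)" for a
    unfolding T_def
    by (simp add: convolution_sum[OF clinear_scalar_right antipode_linear e'(1)] scalar_right_of)
  have T: "clinear T"
    unfolding T_sum[abs_def] by (intro clinear_intros e')
  have M_scale: "exp_mult (c *\<^sub>C t) = c *\<^sub>C exp_mult t" for c t
    using exp_mult_linear by (simp add: clinear_iff)
  have "exp_mult ((T \<otimes>\<^sub>m id) (\<Delta> a)) = \<delta> a *\<^sub>C unit" for a
  proof -
    have "exp_mult ((T \<otimes>\<^sub>m id) (\<Delta> a)) = (\<Sum>x \<otimes> y \<leftarrow> \<Delta> a. exp_mult (T x \<otimes> y))"
      using convolution_sum[OF exp_mult_linear T clinear_id, of a]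
      by (simp only: convolution_def[of \<Delta> exp_mult] o_apply id_apply)
    also have "\<dots> = (\<Sum>x \<otimes> y \<leftarrow> \<Delta> a. \<Sum>x1 \<otimes> x2 \<leftarrow> \<Delta> x. ?e' x2 *\<^sub>C exp_mult (S x1 \<otimes> y))"
      by (simp only: T_sum clinear_tensor_sum[OF clinear_tensor_of(1)] tensor_scale_left
          clinear_tensor_sum[OF exp_mult_linear] M_scale)
    also have "\<dots> = (\<Sum>x1 \<otimes> r \<leftarrow> \<Delta> a. \<Sum>x2 \<otimes> y \<leftarrow> \<Delta> r. ?e' x2 *\<^sub>C exp_mult (S x1 \<otimes> y))"
      by (rule coassoc_sum) (intro clinear_intros e' M)+
    also have "\<dots> = (\<Sum>w \<otimes> r \<leftarrow> \<Delta> a. ?e' w *\<^sub>C (\<Sum>x \<otimes> y \<leftarrow> \<Delta> r. exp_mult (S x \<otimes> y)))"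
      by (rule conv_central_middle) (rule e' | intro clinear_intros M)+
    also have "\<dots> = (\<Sum>w \<otimes> r \<leftarrow> \<Delta> a. ?e' w *\<^sub>C (?e r *\<^sub>C unit))"
      by (simp only: exp_mult_antipode_id[OF K] flip: clinear_tensor_sum[OF exp_mult_linear])
    also have "\<dots> = (\<Sum>w \<otimes> r \<leftarrow> \<Delta> a. ?e' r *\<^sub>C (?e w *\<^sub>C unit))"
      by (rule conv_centralD[symmetric]) (rule e' | intro clinear_intros e)+
    also have "\<dots> = (\<Sum>w \<otimes> r \<leftarrow> \<Delta> a. ?e w * ?e' r) *\<^sub>C unit"
      by (simp only: tensor_sum_scaleC scaleC_scaleC mult.commute)
    finally show ?thesis by (simp only: conv_exp_uminus[OF \<kappa>_linear])
  qed
  moreover have "exp_mult ((id \<otimes>\<^sub>m T) (\<Delta> a)) = \<delta> a *\<^sub>C unit" for a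
  proof -
    have "exp_mult ((id \<otimes>\<^sub>m T) (\<Delta> a)) = (\<Sum>x \<otimes> y \<leftarrow> \<Delta> a. exp_mult (x \<otimes> T y))"
      using convolution_sum[OF exp_mult_linear clinear_id T, of a]
      by (simp only: convolution_def[of \<Delta> exp_mult] o_apply id_apply)
    also have "\<dots> = (\<Sum>x \<otimes> y \<leftarrow> \<Delta> a. \<Sum>y1 \<otimes> y2 \<leftarrow> \<Delta> y. ?e' y2 *\<^sub>C exp_mult (x \<otimes> S y1))"
      by (simp only: T_sum clinear_tensor_sum[OF clinear_tensor_of(2)] tensor_scale_right
          clinear_tensor_sum[OF exp_mult_linear] M_scale)
    also have "\<dots> = (\<Sum>w \<otimes> y2 \<leftarrow> \<Delta> a. \<Sum>x \<otimes> y1 \<leftarrow> \<Delta> w. ?e' y2 *\<^sub>C exp_mult (x \<otimes> S y1))"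
      by (rule coassoc_sum[symmetric]) (intro clinear_intros e' M)+
    also have "\<dots> = (\<Sum>w \<otimes> y2 \<leftarrow> \<Delta> a. ?e' y2 *\<^sub>C (?e w *\<^sub>C unit))"
      by (simp only: exp_mult_id_antipode
          flip: scaleC_tensor_sum clinear_tensor_sum[OF exp_mult_linear])
    also have "\<dots> = (\<Sum>w \<otimes> r \<leftarrow> \<Delta> a. ?e w * ?e' r) *\<^sub>C unit"
      by (simp only: tensor_sum_scaleC scaleC_scaleC mult.commute)
    finally show ?thesis by (simp only: conv_exp_uminus[OF \<kappa>_linear])
  qed
  ultimately show ?thesis
    using T by (simp add: is_antipode_def fun_eq_iff T_def)
qed

end

section \<open>Generators of additive deformations\<close>

text \<open>An additive deformation is controlled on \<open>t \<ge> 0\<close> only, so identities between values of the generator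
are obtained from one-sided derivatives.\<close>

lemma right_derivative_unique:
  fixes f g :: "real \<Rightarrow> complex"
  assumes f: "(f has_vector_derivative a) (at 0 within {0..})"
    and g: "(g has_vector_derivative b) (at 0 within {0..})"
    and eq: "\<And>t. 0 \<le> t \<Longrightarrow> f t = g t"
  shows "a = b"
proof -
  have "((\<lambda>t. f t - g t) has_vector_derivative a - b) (at 0 within {0..})"
    by (intro has_vector_derivative_diff f g)
  then have "((\<lambda>t. 0) has_derivative (\<lambda>t. t *\<^sub>R (a - b))) (at 0 within {0..})"
    unfolding has_vector_derivative_def by (rule has_derivative_transform[rotated 2]) (simp_all add: eq)
  then have "((\<lambda>t. (1 / norm t) *\<^sub>R (- (t *\<^sub>R (a - b)))) \<longlongrightarrow> 0) (at_right 0)"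
    unfolding has_derivative_within by (simp add: at_within_Ici_at_right)
  moreover have "\<forall>\<^sub>F t in at_right (0::real). (1 / norm t) *\<^sub>R (- (t *\<^sub>R (a - b))) = - (a - b)"
    using eventually_at_right_less[of 0] by eventually_elim (simp add: field_simps scaleR_conv_of_real)
  ultimately have "((\<lambda>t::real. - (a - b)) \<longlongrightarrow> 0) (at_right 0)"
    by (simp only: tendsto_cong)
  then show ?thesis
    using tendsto_unique[OF trivial_limit_at_right_real _ tendsto_const] by fastforce
qed

locale deformed_bialgebra = bialgebra \<mu> unit \<Delta> \<delta>
  for \<mu> :: "'b::complex_vector \<otimes> 'b \<Rightarrow> 'b" and unit :: 'b
    and \<Delta> :: "'b \<Rightarrow> 'b \<otimes> 'b" and \<delta> :: "'b \<Rightarrow> complex" +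
  fixes M :: "real \<Rightarrow> 'b \<otimes> 'b \<Rightarrow> 'b" and L :: "'b \<otimes> 'b \<Rightarrow> complex"
  assumes deformation: "additive_deformation \<mu> unit \<Delta> \<delta> M"
    and generator: "is_generator \<delta> M L"
begin

lemma deformed_algebra: "0 \<le> t \<Longrightarrow> unital_algebra (M t) unit"
  using deformation by (simp add: additive_deformation_def)

lemmas deformed_linear = unital_algebra.mult_linear[OF deformed_algebra]

lemma M_0: "M 0 = \<mu>"
  using deformation by (simp add: additive_deformation_def)

lemma comult_deformed: "0 \<le> t \<Longrightarrow> 0 \<le> s \<Longrightarrow> \<Delta> (M (t + s) x) = (M t \<otimes>\<^sub>m M s) (tensor_comult \<Delta> x)"
  using deformation by (simp add: additive_deformation_def fun_eq_iff)

lemma generator_derivative: "((\<lambda>t. \<delta> (M t x)) has_vector_derivative L x) (at 0 within {0..})"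
  using generator by (simp add: is_generator_def)

lemma generator_linear: "clinear L"
  unfolding clinear_iff
proof (intro conjI allI)
  fix x y c
  have phi: "clinear (\<lambda>x. \<delta> (M t x))" if "0 \<le> t" for t
    using clinear_comp[OF counit_linear deformed_linear[OF that]] .
  show "L (x + y) = L x + L y"
    by (rule right_derivative_unique[OF generator_derivative
          has_vector_derivative_add[OF generator_derivative generator_derivative]])
      (use phi in \<open>simp add: clinear_iff\<close>)
  show "L (c *\<^sub>C x) = c *\<^sub>C L x"
    unfolding scaleC_complex_def
    by (rule right_derivative_unique[OF generator_derivative
          has_vector_derivative_mult_right[OF generator_derivative]])
      (use phi in \<open>simp add: clinear_iff scaleC_complex_def\<close>)
qed

text \<open>Apply the counit to the first leg of \<open>\<Delta> \<circ> \<mu>\<^sub>t = (\<mu>\<^sub>t \<otimes> \<mu>\<^sub>0) \<circ> \<dots>\<close>. Together with the mirror image this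
expresses \<open>\<mu>\<^sub>t\<close> through \<open>\<delta> \<circ> \<mu>\<^sub>t\<close>, whose derivative is the generator, without any exponential series.\<close>

lemma deformed_eq_left:
  assumes "0 \<le> t"
  shows "M t x = (\<Sum>p \<otimes> q \<leftarrow> tensor_comult \<Delta> x. \<delta> (M t p) *\<^sub>C \<mu> q)"
proof -
  have "M t x = (\<Sum>u \<otimes> v \<leftarrow> \<Delta> (M (t + 0) x). \<delta> u *\<^sub>C v)"
    using counit_left_sum[OF clinear_ident, of "M t x"] by simp
  also have "\<dots> = (\<Sum>p \<otimes> q \<leftarrow> tensor_comult \<Delta> x. \<delta> (M t p) *\<^sub>C \<mu> q)"
    unfolding comult_deformed[OF assms order_refl] M_0
    by (rule tensor_sum_tensor_map) (intro clinear_intros deformed_linear[OF assms] mult_linear)+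
  finally show ?thesis .
qed

lemma deformed_eq_right:
  assumes "0 \<le> t"
  shows "M t x = (\<Sum>p \<otimes> q \<leftarrow> tensor_comult \<Delta> x. \<delta> (M t q) *\<^sub>C \<mu> p)"
proof -
  have "M t x = (\<Sum>u \<otimes> v \<leftarrow> \<Delta> (M (0 + t) x). \<delta> v *\<^sub>C u)"
    using counit_right_sum[OF clinear_ident, of "M t x"] by simp
  also have "\<dots> = (\<Sum>p \<otimes> q \<leftarrow> tensor_comult \<Delta> x. \<delta> (M t q) *\<^sub>C \<mu> p)"
    unfolding comult_deformed[OF order_refl assms] M_0
    by (rule tensor_sum_tensor_map) (intro clinear_intros deformed_linear[OF assms] mult_linear counit_linear)+
  finally show ?thesis .
qed

text \<open>Both expressions are derivatives at \<open>0\<close> of \<open>\<mu>\<^sub>t\<close>, expanded by \<open>deformed_eq_right\<close> and by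
\<open>deformed_eq_left\<close>.\<close>

lemma generator_commutes:
  "(\<Sum>p \<otimes> q \<leftarrow> tensor_comult \<Delta> x. L q *\<^sub>C \<mu> p) = (\<Sum>p \<otimes> q \<leftarrow> tensor_comult \<Delta> x. L p *\<^sub>C \<mu> q)"
proof (rule functionals_separate)
  fix \<psi> :: "'b \<Rightarrow> complex"
  assume \<psi>: "clinear \<psi>"
  have \<psi>_sum: "\<psi> (\<Sum>p \<otimes> q \<leftarrow> t. f p q *\<^sub>C g p q) = (\<Sum>p \<otimes> q \<leftarrow> t. f p q * \<psi> (g p q))"
    for t :: "('b \<otimes> 'b) \<otimes> ('b \<otimes> 'b)" and f g
    using \<psi> by (simp add: clinear_tensor_sum[OF \<psi>] clinear_iff scaleC_complex_def)
  have "((\<lambda>t. \<Sum>p \<otimes> q \<leftarrow> tensor_comult \<Delta> x. \<delta> (M t q) * \<psi> (\<mu> p)) has_vector_derivative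
      (\<Sum>p \<otimes> q \<leftarrow> tensor_comult \<Delta> x. L q * \<psi> (\<mu> p))) (at 0 within {0..})"
    "((\<lambda>t. \<Sum>p \<otimes> q \<leftarrow> tensor_comult \<Delta> x. \<delta> (M t p) * \<psi> (\<mu> q)) has_vector_derivative
      (\<Sum>p \<otimes> q \<leftarrow> tensor_comult \<Delta> x. L p * \<psi> (\<mu> q))) (at 0 within {0..})"
    by (intro has_vector_derivative_tensor_sum has_vector_derivative_mult_left generator_derivative)+
  then have "(\<Sum>p \<otimes> q \<leftarrow> tensor_comult \<Delta> x. L q * \<psi> (\<mu> p)) = (\<Sum>p \<otimes> q \<leftarrow> tensor_comult \<Delta> x. L p * \<psi> (\<mu> q))"
  proof (rule right_derivative_unique)
    fix t :: real
    assume "0 \<le> t"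
    then have "\<psi> (\<Sum>p \<otimes> q \<leftarrow> tensor_comult \<Delta> x. \<delta> (M t q) *\<^sub>C \<mu> p)
        = \<psi> (\<Sum>p \<otimes> q \<leftarrow> tensor_comult \<Delta> x. \<delta> (M t p) *\<^sub>C \<mu> q)"
      by (simp only: flip: deformed_eq_left deformed_eq_right)
    then show "(\<Sum>p \<otimes> q \<leftarrow> tensor_comult \<Delta> x. \<delta> (M t q) * \<psi> (\<mu> p))
        = (\<Sum>p \<otimes> q \<leftarrow> tensor_comult \<Delta> x. \<delta> (M t p) * \<psi> (\<mu> q))"
      by (simp only: \<psi>_sum)
  qed
  then show "\<psi> (\<Sum>p \<otimes> q \<leftarrow> tensor_comult \<Delta> x. L q *\<^sub>C \<mu> p)
      = \<psi> (\<Sum>p \<otimes> q \<leftarrow> tensor_comult \<Delta> x. L p *\<^sub>C \<mu> q)"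
    by (simp only: \<psi>_sum)
qed

lemma generator_unit: "L (unit \<otimes> a) = 0" "L (a \<otimes> unit) = 0"
proof -
  show "L (unit \<otimes> a) = 0"
    by (rule right_derivative_unique[OF generator_derivative has_vector_derivative_const[of "\<delta> a"]])
      (simp add: unital_algebra.unit_left[OF deformed_algebra])
  show "L (a \<otimes> unit) = 0"
    by (rule right_derivative_unique[OF generator_derivative has_vector_derivative_const[of "\<delta> a"]])
      (simp add: unital_algebra.unit_right[OF deformed_algebra])
qed

text \<open>The two sides are the derivatives at \<open>0\<close> of \<open>\<delta>(\<mu>\<^sub>t(\<mu>\<^sub>t(a \<otimes> b) \<otimes> c))\<close> and \<open>\<delta>(\<mu>\<^sub>t(a \<otimes> \<mu>\<^sub>t(b \<otimes> c)))\<close>. The inner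
\<open>\<mu>\<^sub>t\<close> is expanded as \<open>\<mu> \<star> (\<delta> \<circ> \<mu>\<^sub>t)\<close>, which leaves a finite sum of products of two scalar functions of \<open>t\<close>.\<close>

lemma generator_cocycle:
  "L ((a \<cdot> b) \<otimes> c) + L (a \<otimes> b) * \<delta> c = L (a \<otimes> (b \<cdot> c)) + \<delta> a * L (b \<otimes> c)"
proof -
  interpret T: coalgebra "tensor_comult \<Delta>" "tensor_counit \<delta>"
    by (rule tensor_coalgebra)
  note [clinear_intros] = clinear_comp[OF generator_linear]
  have expand: "\<delta> (M t (f (M t x))) = (\<Sum>p \<otimes> q \<leftarrow> tensor_comult \<Delta> x. \<delta> (M t q) * \<delta> (M t (f (\<mu> p))))"
    if "0 \<le> t" "clinear f" for t f x
  proof -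
    have h: "clinear (\<lambda>y. \<delta> (M t (f y)))"
      by (intro clinear_intros clinear_comp[OF deformed_linear] that)
    have "\<delta> (M t (f (\<Sum>p \<otimes> q \<leftarrow> tensor_comult \<Delta> x. \<delta> (M t q) *\<^sub>C \<mu> p)))
        = (\<Sum>p \<otimes> q \<leftarrow> tensor_comult \<Delta> x. \<delta> (M t q) * \<delta> (M t (f (\<mu> p))))"
      unfolding clinear_tensor_sum[OF h] using h by (simp add: clinear_iff scaleC_complex_def)
    then show ?thesis
      by (simp only: flip: deformed_eq_right[OF \<open>0 \<le> t\<close>, of x])
  qed
  \<comment> \<open>The product rule at \<open>0\<close>; in one of the two terms \<open>\<delta> \<circ> \<mu>\<^sub>0\<close> is the counit, which removes the sum.\<close>
  have deriv: "((\<lambda>t. \<Sum>p \<otimes> q \<leftarrow> tensor_comult \<Delta> x. \<delta> (M t q) * \<delta> (M t (f (\<mu> p))))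
      has_vector_derivative L (f (\<mu> x)) + (\<Sum>p \<otimes> q \<leftarrow> tensor_comult \<Delta> x. L q * \<delta> (\<mu> (f (\<mu> p))))) (at 0 within {0..})"
    if "clinear f" for f x
  proof -
    have "((\<lambda>t. \<Sum>p \<otimes> q \<leftarrow> tensor_comult \<Delta> x. \<delta> (M t q) * \<delta> (M t (f (\<mu> p)))) has_vector_derivative
        (\<Sum>p \<otimes> q \<leftarrow> tensor_comult \<Delta> x. \<delta> (M 0 q) * L (f (\<mu> p)) + L q * \<delta> (M 0 (f (\<mu> p))))) (at 0 within {0..})"
      by (intro has_vector_derivative_tensor_sum has_vector_derivative_mult generator_derivative)
    moreover have "(\<Sum>p \<otimes> q \<leftarrow> tensor_comult \<Delta> x. \<delta> (M 0 q) * L (f (\<mu> p))) = L (f (\<mu> x))"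
      unfolding M_0 tensor_counit_mult[symmetric] scaleC_complex_def[symmetric]
      by (rule T.counit_right_sum) (intro clinear_intros clinear_comp[OF that] mult_linear)
    ultimately show ?thesis
      by (simp only: tensor_sum_add M_0)
  qed
  have left: "(\<Sum>p \<otimes> q \<leftarrow> tensor_comult \<Delta> (a \<otimes> b). L q * \<delta> (\<mu> (\<mu> p \<otimes> c))) = L (a \<otimes> b) * \<delta> c"
  proof -
    have "(\<Sum>p \<otimes> q \<leftarrow> tensor_comult \<Delta> (a \<otimes> b). L q * \<delta> (\<mu> (\<mu> p \<otimes> c)))
        = (\<Sum>p \<otimes> q \<leftarrow> tensor_comult \<Delta> (a \<otimes> b). tensor_counit \<delta> p *\<^sub>C (L q * \<delta> c))"
      by (simp add: counit_mult_of tensor_counit_mult scaleC_complex_def mult_ac)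
    then show ?thesis
      by (simp only:) (rule T.counit_left_sum, intro clinear_intros generator_linear)
  qed
  have right: "(\<Sum>p \<otimes> q \<leftarrow> tensor_comult \<Delta> (b \<otimes> c). L q * \<delta> (\<mu> (a \<otimes> \<mu> p))) = \<delta> a * L (b \<otimes> c)"
  proof -
    have "(\<Sum>p \<otimes> q \<leftarrow> tensor_comult \<Delta> (b \<otimes> c). L q * \<delta> (\<mu> (a \<otimes> \<mu> p)))
        = (\<Sum>p \<otimes> q \<leftarrow> tensor_comult \<Delta> (b \<otimes> c). tensor_counit \<delta> p *\<^sub>C (\<delta> a * L q))"
      by (simp add: counit_mult_of tensor_counit_mult scaleC_complex_def mult_ac)
    then show ?thesis
      by (simp only:) (rule T.counit_left_sum, intro clinear_intros generator_linear)
  qed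
  show ?thesis
    unfolding left[symmetric] right[symmetric]
  proof (rule right_derivative_unique)
    show "((\<lambda>t. \<Sum>p \<otimes> q \<leftarrow> tensor_comult \<Delta> (a \<otimes> b). \<delta> (M t q) * \<delta> (M t (\<mu> p \<otimes> c)))
      has_vector_derivative L ((a \<cdot> b) \<otimes> c) + (\<Sum>p \<otimes> q \<leftarrow> tensor_comult \<Delta> (a \<otimes> b). L q * \<delta> (\<mu> (\<mu> p \<otimes> c)))) (at 0 within {0..})"
      by (rule deriv[of "\<lambda>y. y \<otimes> c"]) (intro clinear_intros)
    show "((\<lambda>t. \<Sum>p \<otimes> q \<leftarrow> tensor_comult \<Delta> (b \<otimes> c). \<delta> (M t q) * \<delta> (M t (a \<otimes> \<mu> p)))
      has_vector_derivative L (a \<otimes> (b \<cdot> c)) + (\<Sum>p \<otimes> q \<leftarrow> tensor_comult \<Delta> (b \<otimes> c). L q * \<delta> (\<mu> (a \<otimes> \<mu> p)))) (at 0 within {0..})"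
      by (rule deriv[of "\<lambda>y. a \<otimes> y"]) (intro clinear_intros)
    fix t :: real
    assume t: "0 \<le> t"
    have "\<delta> (M t (M t (a \<otimes> b) \<otimes> c)) = \<delta> (M t (a \<otimes> M t (b \<otimes> c)))"
      by (simp add: unital_algebra.mult_assoc_of[OF deformed_algebra[OF t]])
    then show "(\<Sum>p \<otimes> q \<leftarrow> tensor_comult \<Delta> (a \<otimes> b). \<delta> (M t q) * \<delta> (M t (\<mu> p \<otimes> c)))
        = (\<Sum>p \<otimes> q \<leftarrow> tensor_comult \<Delta> (b \<otimes> c). \<delta> (M t q) * \<delta> (M t (a \<otimes> \<mu> p)))"
      by (simp only: expand[OF t clinear_tensor_of(1)] expand[OF t clinear_tensor_of(2)])
  qed
qed

end

locale deformed_hopf_algebra = deformed_bialgebra \<mu> unit \<Delta> \<delta> M L + hopf_algebra \<mu> unit \<Delta> \<delta> S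
  for \<mu> :: "'b::complex_vector \<otimes> 'b \<Rightarrow> 'b" and unit \<Delta> \<delta> S M L
begin

text \<open>Evaluate the cocycle identity at \<open>a\<^sub>1 \<otimes> S a\<^sub>2 \<otimes> a\<^sub>3\<close>. The terms with a product inside \<open>L\<close> collapse to
\<open>L(1 \<otimes> a)\<close> and \<open>L(a \<otimes> 1)\<close>, which vanish, and the other two are the sides of the claim.\<close>

lemma generator_antipode_sym:
  "L (\<Sum>x \<otimes> y \<leftarrow> \<Delta> a. S x \<otimes> y) = L (\<Sum>x \<otimes> y \<leftarrow> \<Delta> a. x \<otimes> S y)"
proof -
  note [clinear_intros] = clinear_comp[OF generator_linear]
  let ?C = "\<lambda>x y z. L ((x \<cdot> S y) \<otimes> z) + L (x \<otimes> S y) * \<delta> z"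
  let ?D = "\<lambda>x y z. L (x \<otimes> (S y \<cdot> z)) + \<delta> x * L (S y \<otimes> z)"
  have "(\<Sum>w \<otimes> z \<leftarrow> \<Delta> a. \<Sum>x \<otimes> y \<leftarrow> \<Delta> w. L ((x \<cdot> S y) \<otimes> z))
      = (\<Sum>w \<otimes> z \<leftarrow> \<Delta> a. \<delta> w *\<^sub>C L (unit \<otimes> z))"
    by (subst antipode_right_sum) (intro clinear_intros refl)+
  moreover have "(\<Sum>w \<otimes> z \<leftarrow> \<Delta> a. \<Sum>x \<otimes> y \<leftarrow> \<Delta> w. L (x \<otimes> S y) * \<delta> z)
      = L (\<Sum>x \<otimes> y \<leftarrow> \<Delta> a. x \<otimes> S y)"
  proof -
    have "(\<Sum>w \<otimes> z \<leftarrow> \<Delta> a. \<Sum>x \<otimes> y \<leftarrow> \<Delta> w. L (x \<otimes> S y) * \<delta> z)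
        = (\<Sum>w \<otimes> z \<leftarrow> \<Delta> a. \<delta> z *\<^sub>C L (\<Sum>x \<otimes> y \<leftarrow> \<Delta> w. x \<otimes> S y))"
      by (simp only: clinear_tensor_sum[OF generator_linear] mult_tensor_sum
          scaleC_complex_def mult.commute)
    also have "\<dots> = L (\<Sum>x \<otimes> y \<leftarrow> \<Delta> a. x \<otimes> S y)"
      by (rule counit_right_sum) (intro clinear_intros)
    finally show ?thesis .
  qed
  ultimately have left: "(\<Sum>w \<otimes> z \<leftarrow> \<Delta> a. \<Sum>x \<otimes> y \<leftarrow> \<Delta> w. ?C x y z) = L (\<Sum>x \<otimes> y \<leftarrow> \<Delta> a. x \<otimes> S y)"
    by (simp add: tensor_sum_add generator_unit)
  have "(\<Sum>x \<otimes> w \<leftarrow> \<Delta> a. \<Sum>y \<otimes> z \<leftarrow> \<Delta> w. L (x \<otimes> (S y \<cdot> z)))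
      = (\<Sum>x \<otimes> w \<leftarrow> \<Delta> a. \<delta> w *\<^sub>C L (x \<otimes> unit))"
    by (subst antipode_left_sum) (intro clinear_intros refl)+
  moreover have "(\<Sum>x \<otimes> w \<leftarrow> \<Delta> a. \<Sum>y \<otimes> z \<leftarrow> \<Delta> w. \<delta> x * L (S y \<otimes> z))
      = L (\<Sum>x \<otimes> y \<leftarrow> \<Delta> a. S x \<otimes> y)"
  proof -
    have "(\<Sum>x \<otimes> w \<leftarrow> \<Delta> a. \<Sum>y \<otimes> z \<leftarrow> \<Delta> w. \<delta> x * L (S y \<otimes> z))
        = (\<Sum>x \<otimes> w \<leftarrow> \<Delta> a. \<delta> x *\<^sub>C L (\<Sum>x \<otimes> y \<leftarrow> \<Delta> w. S x \<otimes> y))"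
      by (simp only: clinear_tensor_sum[OF generator_linear] mult_tensor_sum[symmetric]
          scaleC_complex_def)
    also have "\<dots> = L (\<Sum>x \<otimes> y \<leftarrow> \<Delta> a. S x \<otimes> y)"
      by (rule counit_left_sum) (intro clinear_intros)
    finally show ?thesis .
  qed
  ultimately have right: "(\<Sum>x \<otimes> w \<leftarrow> \<Delta> a. \<Sum>y \<otimes> z \<leftarrow> \<Delta> w. ?D x y z) = L (\<Sum>x \<otimes> y \<leftarrow> \<Delta> a. S x \<otimes> y)"
    by (simp add: tensor_sum_add generator_unit)
  have "(\<Sum>w \<otimes> z \<leftarrow> \<Delta> a. \<Sum>x \<otimes> y \<leftarrow> \<Delta> w. ?C x y z) = (\<Sum>x \<otimes> w \<leftarrow> \<Delta> a. \<Sum>y \<otimes> z \<leftarrow> \<Delta> w. ?C x y z)"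
    by (rule coassoc_sum) (intro clinear_add clinear_intros)+
  also have "\<dots> = (\<Sum>x \<otimes> w \<leftarrow> \<Delta> a. \<Sum>y \<otimes> z \<leftarrow> \<Delta> w. ?D x y z)"
    by (simp only: generator_cocycle)
  finally show ?thesis unfolding left right ..
qed

lemma generator_commuting_functional:
  "commuting_functional \<mu> unit \<Delta> \<delta> S (\<lambda>x. c * L x)"
proof (intro commuting_functional.intro commuting_functional_axioms.intro)
  show "hopf_algebra \<mu> unit \<Delta> \<delta> S" ..
  show "clinear (\<lambda>x. c * L x)"
    by (intro clinear_intros generator_linear)
  show "(\<Sum>p \<otimes> q \<leftarrow> tensor_comult \<Delta> x. (c * L q) *\<^sub>C \<mu> p)
      = (\<Sum>p \<otimes> q \<leftarrow> tensor_comult \<Delta> x. (c * L p) *\<^sub>C \<mu> q)" for x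
    by (simp only: generator_commutes flip: scaleC_scaleC scaleC_tensor_sum)
qed

theorem is_antipode_deformed:
  "is_antipode (deformed_mult \<mu> \<Delta> \<delta> L t) unit \<Delta> \<delta>
    (convolution \<Delta> scalar_right S (conv_exp \<Delta> \<delta> (\<lambda>a. - of_real t * (L \<circ> (id \<otimes>\<^sub>m S) \<circ> \<Delta>) a)))"
proof -
  interpret K: commuting_functional \<mu> unit \<Delta> \<delta> S "\<lambda>x. of_real t * L x"
    by (rule generator_commuting_functional)
  have "(id \<otimes>\<^sub>m S) (\<Delta> a) = (\<Sum>x \<otimes> y \<leftarrow> \<Delta> a. x \<otimes> S y)" for a
    by (subst clinear_eq_tensor_sum[of "id \<otimes>\<^sub>m S"])
      (simp_all add: clinear_tensor_map clinear_id antipode_linear tensor_map_of)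
  then have "(\<lambda>a. - of_real t * (L \<circ> (id \<otimes>\<^sub>m S) \<circ> \<Delta>) a) = (\<lambda>a. - K.\<kappa> a)"
    by (simp add: K.\<kappa>_def fun_eq_iff)
  then show ?thesis
    using K.is_antipode_exp by (simp add: deformed_mult_def K.\<kappa>_def generator_antipode_sym)
qed

end

section \<open>Deformed antipodes\<close>

theorem theorem6:
  fixes \<mu> :: "'b::complex_vector \<otimes> 'b \<Rightarrow> 'b" and unit :: 'b
    and \<Delta> :: "'b \<Rightarrow> 'b \<otimes> 'b" and \<delta> :: "'b \<Rightarrow> complex" and S :: "'b \<Rightarrow> 'b"
    and M :: "real \<Rightarrow> 'b \<otimes> 'b \<Rightarrow> 'b" and L :: "'b \<otimes> 'b \<Rightarrow> complex"
    and \<sigma> :: "'b \<Rightarrow> complex"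
  assumes "hopf_algebra \<mu> unit \<Delta> \<delta> S"
    and "additive_deformation \<mu> unit \<Delta> \<delta> M"
    and "is_generator \<delta> M L"
    and "\<And>t. M t = deformed_mult \<mu> \<Delta> \<delta> L t"
    and "\<sigma> = L \<circ> (id \<otimes>\<^sub>m S) \<circ> \<Delta>"
  shows "hopf_deformation \<mu> unit \<Delta> \<delta> M
    \<and> (\<forall>t. is_antipode (M t) unit \<Delta> \<delta>
          (convolution \<Delta> scalar_right S (conv_exp \<Delta> \<delta> (\<lambda>a. - of_real t * \<sigma> a))))"
proof -
  interpret hopf_algebra \<mu> unit \<Delta> \<delta> S by fact
  interpret deformed_hopf_algebra \<mu> unit \<Delta> \<delta> S M L
    by unfold_locales (rule assms)+
  have "is_antipode (M t) unit \<Delta> \<delta>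
      (convolution \<Delta> scalar_right S (conv_exp \<Delta> \<delta> (\<lambda>a. - of_real t * \<sigma> a)))" for t
    unfolding assms(4) assms(5) by (rule is_antipode_deformed)
  then show ?thesis
    using assms(2) unfolding hopf_deformation_def by blast
qed

end
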